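(* Let $\mathcal{G}=(\mathcal{G}^{(0)},E)$ be a hyperbolic graph of bounded valency. Then there is a weak-* continuous, $\mathrm{Isom}(\mathcal{G})$-equivariant, alternating cocycle $$\omega:(\partial\mathcal{G})^3\longrightarrow\ell^1(E\times E)$$ vanishing nowhere on $\partial^3\mathcal{G}$.
   Context: Graphs are connected, in Serre's sense, with edge set $E$ and path metric of unit edge length; bounded valency means a uniform bound on the number of edges issuing from a vertex; hyperbolic means Gromov-hyperbolic, with Gromov boundary $\partial\mathcal{G}$. $\partial^3\mathcal{G}\subseteq(\partial\mathcal{G})^3$ is the subset of triples of pairwise distinct points. $\mathrm{Isom}(\mathcal{G})$ is the automorphism group of $\mathcal{G}$, acting naturally on $\partial\mathcal{G}$ and on $\ell^1(E\times E)$. The weak-* topology on $\ell^1(E\times E)$ is that of the dual of $C_0(E\times E)$ (functions vanishing at infinity on the discrete set $E\times E$). Cocycle means $\omega(\eta,\zeta,\theta)-\omega(\xi,\zeta,\theta)+\omega(\xi,\eta,\theta)-\omega(\xi,\eta,\zeta)=0$ for all $\xi,\eta,\zeta,\theta\in\partial\mathcal{G}$; alternating means that permuting the variables multiplies $\omega$ by the sign of the permutation. *)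

theory Defs
  imports "HOL-Analysis.Analysis" "Graph_Theory.Graph_Theory"
begin

section \<open>Graphs in the sense of Serre\<close>

text \<open>
  A graph in Serre's sense is a directed multigraph with a fixed-point-free
  involution on its (oriented) edges that exchanges origin and terminus; this is
  \<^locale>\<open>bidirected_digraph\<close>, with loops and multiple edges allowed. That locale normalises
  the involution to be the identity outside \<^term>\<open>arcs G\<close>.
\<close>

definition serre_graph :: "('v, 'e) pre_digraph \<Rightarrow> ('e \<Rightarrow> 'e) \<Rightarrow> bool" where
  "serre_graph G arev \<longleftrightarrow> bidirected_digraph G arev \<and> Digraph_Component.connected G"

definition bounded_valency :: "('v, 'e) pre_digraph \<Rightarrow> bool" where
  "bounded_valency G \<longleftrightarrow>
     (\<exists>N::nat. \<forall>v\<in>verts G. finite (out_arcs G v) \<and> card (out_arcs G v) \<le> N)"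

definition graph_dist :: "('v, 'e) pre_digraph \<Rightarrow> 'v \<Rightarrow> 'v \<Rightarrow> nat" where
  "graph_dist G u v = Inf (length ` {p. pre_digraph.awalk G u p v})"

definition graph_automorphism ::
    "('v, 'e) pre_digraph \<Rightarrow> ('e \<Rightarrow> 'e) \<Rightarrow> ('v \<Rightarrow> 'v) \<Rightarrow> ('e \<Rightarrow> 'e) \<Rightarrow> bool" where
  "graph_automorphism G arev \<phi> \<psi> \<longleftrightarrow>
     bij_betw \<phi> (verts G) (verts G) \<and> bij_betw \<psi> (arcs G) (arcs G) \<and>
     (\<forall>e\<in>arcs G. tail G (\<psi> e) = \<phi> (tail G e) \<and> head G (\<psi> e) = \<phi> (head G e) \<and>
                 arev (\<psi> e) = \<psi> (arev e))"

section \<open>Hyperbolicity and the Gromov boundary\<close>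

definition gromov_product :: "('v, 'e) pre_digraph \<Rightarrow> 'v \<Rightarrow> 'v \<Rightarrow> 'v \<Rightarrow> real" where
  "gromov_product G b x y =
     (real (graph_dist G x b) + real (graph_dist G y b) - real (graph_dist G x y)) / 2"

text \<open>
  Gromov's inequality on the metric space of vertices. The geometric realisation contains this
  space isometrically as a 1/2-dense subset, so it satisfies the inequality for some \<open>\<delta>\<close> iff the
  vertex set does, and both have the same boundary.
\<close>

definition hyperbolic_graph :: "('v, 'e) pre_digraph \<Rightarrow> bool" where
  "hyperbolic_graph G \<longleftrightarrow>
     (\<exists>\<delta>\<ge>0. \<forall>x\<in>verts G. \<forall>y\<in>verts G. \<forall>z\<in>verts G. \<forall>b\<in>verts G.
        gromov_product G b x z \<ge> min (gromov_product G b x y) (gromov_product G b y z) - \<delta>)"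

text \<open>
  Divergence of the double sequence \<open>(x\<^sub>i | y\<^sub>j)\<close> as \<open>i, j \<rightarrow> \<infinity>\<close>. In this and the
  following definitions, quantifying over all base points avoids choosing one; all of them give
  the same notion.
\<close>

definition gromov_asymptotic ::
    "('v, 'e) pre_digraph \<Rightarrow> (nat \<Rightarrow> 'v) \<Rightarrow> (nat \<Rightarrow> 'v) \<Rightarrow> bool" where
  "gromov_asymptotic G x y \<longleftrightarrow>
     (\<forall>b\<in>verts G. filterlim (\<lambda>(i, j). gromov_product G b (x i) (y j)) at_top
                     (sequentially \<times>\<^sub>F sequentially))"

definition gromov_sequences :: "('v, 'e) pre_digraph \<Rightarrow> (nat \<Rightarrow> 'v) set" where
  "gromov_sequences G = {x. range x \<subseteq> verts G \<and> gromov_asymptotic G x x}"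

definition gromov_boundary :: "('v, 'e) pre_digraph \<Rightarrow> (nat \<Rightarrow> 'v) set set" where
  "gromov_boundary G = gromov_sequences G //
     {(x, y). x \<in> gromov_sequences G \<and> y \<in> gromov_sequences G \<and> gromov_asymptotic G x y}"

definition boundary_product ::
    "('v, 'e) pre_digraph \<Rightarrow> 'v \<Rightarrow> (nat \<Rightarrow> 'v) set \<Rightarrow> (nat \<Rightarrow> 'v) set \<Rightarrow> ereal" where
  "boundary_product G b \<xi> \<eta> =
     (SUP (x, y) \<in> \<xi> \<times> \<eta>. Liminf (sequentially \<times>\<^sub>F sequentially)
        (\<lambda>(i, j). ereal (gromov_product G b (x i) (y j))))"

text \<open>
  The usual topology, in which the sets \<open>{\<eta>. (\<xi> | \<eta>)\<^sub>b > r}\<close> (not necessarily open themselves)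
  form a neighbourhood base at \<open>\<xi>\<close>.
\<close>

definition boundary_topology :: "('v, 'e) pre_digraph \<Rightarrow> (nat \<Rightarrow> 'v) set topology" where
  "boundary_topology G = topology (\<lambda>U. U \<subseteq> gromov_boundary G \<and>
     (\<forall>\<xi>\<in>U. \<forall>b\<in>verts G. \<exists>r::real.
        {\<eta> \<in> gromov_boundary G. ereal r < boundary_product G b \<xi> \<eta>} \<subseteq> U))"

lemma openin_boundary_topology:
  "openin (boundary_topology G) U \<longleftrightarrow> U \<subseteq> gromov_boundary G \<and>
     (\<forall>\<xi>\<in>U. \<forall>b\<in>verts G. \<exists>r::real.
        {\<eta> \<in> gromov_boundary G. ereal r < boundary_product G b \<xi> \<eta>} \<subseteq> U)"
proof -
  let ?N = "\<lambda>\<xi> b r. {\<eta> \<in> gromov_boundary G. ereal r < boundary_product G b \<xi> \<eta>}"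
  let ?P = "\<lambda>U. U \<subseteq> gromov_boundary G \<and> (\<forall>\<xi>\<in>U. \<forall>b\<in>verts G. \<exists>r::real. ?N \<xi> b r \<subseteq> U)"
  have mono: "?N \<xi> b (max r s) \<subseteq> ?N \<xi> b r \<inter> ?N \<xi> b s" for \<xi> b and r s :: real
    by (auto simp: ereal_max)
  have "istopology ?P"
    unfolding istopology_def
  proof (intro conjI allI impI)
    fix S T assume S: "?P S" and T: "?P T"
    show "S \<inter> T \<subseteq> gromov_boundary G" using S by blast
    show "\<forall>\<xi>\<in>S \<inter> T. \<forall>b\<in>verts G. \<exists>r::real. ?N \<xi> b r \<subseteq> S \<inter> T"
    proof (intro ballI)
      fix \<xi> b assume "\<xi> \<in> S \<inter> T" "b \<in> verts G"
      then have "\<exists>r::real. ?N \<xi> b r \<subseteq> S" and "\<exists>s::real. ?N \<xi> b s \<subseteq> T"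
        using S T by (simp_all only: Int_iff)
      then obtain r s :: real where "?N \<xi> b r \<subseteq> S" "?N \<xi> b s \<subseteq> T"
        by (elim exE)
      then have "?N \<xi> b (max r s) \<subseteq> S \<inter> T"
        by (intro subset_trans[OF mono] Int_mono)
      then show "\<exists>r::real. ?N \<xi> b r \<subseteq> S \<inter> T" by (rule exI)
    qed
  next
    fix K assume K: "\<forall>S\<in>K. ?P S"
    show "\<Union>K \<subseteq> gromov_boundary G" using K by blast
    show "\<forall>\<xi>\<in>\<Union>K. \<forall>b\<in>verts G. \<exists>r::real. ?N \<xi> b r \<subseteq> \<Union>K"
    proof (intro ballI)
      fix \<xi> b assume "\<xi> \<in> \<Union>K" "b \<in> verts G"
      then obtain S where SK: "S \<in> K" and "\<xi> \<in> S" by (elim UnionE)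
      then have "\<exists>r::real. ?N \<xi> b r \<subseteq> S" using K \<open>b \<in> verts G\<close> by (simp only:)
      then obtain r :: real where "?N \<xi> b r \<subseteq> S" by (elim exE)
      then have "?N \<xi> b r \<subseteq> \<Union>K" using Union_upper[OF SK] by (rule subset_trans)
      then show "\<exists>r::real. ?N \<xi> b r \<subseteq> \<Union>K" by (rule exI)
    qed
  qed
  then show ?thesis by (simp add: boundary_topology_def)
qed

lemma topspace_boundary_topology: "topspace (boundary_topology G) = gromov_boundary G"
proof
  show "topspace (boundary_topology G) \<subseteq> gromov_boundary G"
    using openin_boundary_topology[THEN iffD1, OF openin_topspace] by (rule conjunct1)
  have "openin (boundary_topology G) (gromov_boundary G)"
    by (auto simp: openin_boundary_topology)
  then show "gromov_boundary G \<subseteq> topspace (boundary_topology G)"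
    by (rule openin_subset)
qed

definition boundary_action :: "('v \<Rightarrow> 'v) \<Rightarrow> (nat \<Rightarrow> 'v) set \<Rightarrow> (nat \<Rightarrow> 'v) set" where
  "boundary_action \<phi> \<xi> = (\<lambda>x. \<phi> \<circ> x) ` \<xi>"

section \<open>The space $\ell^1$ with its weak-* topology\<close>

text \<open>Functions on a set \<open>A\<close> are represented by functions that vanish outside \<open>A\<close>.\<close>

definition l1_space :: "'a set \<Rightarrow> ('a \<Rightarrow> real) set" where
  "l1_space A = {f. (\<lambda>a. \<bar>f a\<bar>) summable_on A \<and> (\<forall>a. a \<notin> A \<longrightarrow> f a = 0)}"

definition c0_space :: "'a set \<Rightarrow> ('a \<Rightarrow> real) set" where
  "c0_space A = {g. (\<forall>\<epsilon>>0. finite {a\<in>A. \<epsilon> \<le> \<bar>g a\<bar>}) \<and> (\<forall>a. a \<notin> A \<longrightarrow> g a = 0)}"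

text \<open>The initial topology on \<open>\<ell>\<^sup>1(A)\<close> for the pairings with the elements of \<open>C\<^sub>0(A)\<close>.\<close>

definition weak_star_topology :: "'a set \<Rightarrow> ('a \<Rightarrow> real) topology" where
  "weak_star_topology A =
     pullback_topology (l1_space A) (\<lambda>f. \<lambda>g\<in>c0_space A. \<Sum>\<^sub>\<infinity>a\<in>A. f a * g a)
       (product_topology (\<lambda>_. euclideanreal) (c0_space A))"

definition l1_action :: "'e set \<Rightarrow> ('e \<Rightarrow> 'e) \<Rightarrow> ('e \<times> 'e \<Rightarrow> real) \<Rightarrow> ('e \<times> 'e \<Rightarrow> real)" where
  "l1_action E \<psi> f = (\<lambda>(a, b). if a \<in> E \<and> b \<in> E
     then f (inv_into E \<psi> a, inv_into E \<psi> b) else 0)"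

section \<open>Cochains on a set\<close>

definition alternating_on :: "'x set \<Rightarrow> ('x \<Rightarrow> 'x \<Rightarrow> 'x \<Rightarrow> 'p \<Rightarrow> real) \<Rightarrow> bool" where
  "alternating_on X \<omega> \<longleftrightarrow>
     (\<forall>\<sigma> x. \<sigma> permutes {1,2,3::nat} \<longrightarrow> x \<in> {1,2,3} \<rightarrow> X \<longrightarrow>
        (\<forall>p. \<omega> (x (\<sigma> 1)) (x (\<sigma> 2)) (x (\<sigma> 3)) p =
             of_int (sign \<sigma>) * \<omega> (x 1) (x 2) (x 3) p))"

definition cocycle_on :: "'x set \<Rightarrow> ('x \<Rightarrow> 'x \<Rightarrow> 'x \<Rightarrow> 'p \<Rightarrow> real) \<Rightarrow> bool" where
  "cocycle_on X \<omega> \<longleftrightarrow>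
     (\<forall>\<xi>\<in>X. \<forall>\<eta>\<in>X. \<forall>\<zeta>\<in>X. \<forall>\<theta>\<in>X. \<forall>p.
        \<omega> \<eta> \<zeta> \<theta> p - \<omega> \<xi> \<zeta> \<theta> p + \<omega> \<xi> \<eta> \<theta> p - \<omega> \<xi> \<eta> \<zeta> p = 0)"

end

theory Submission
  imports Defs
begin

text \<open>
  For every vertex \<open>v\<close>, Frink's chain construction turns \<open>exp (- \<epsilon> (x|y)\<^sub>v)\<close> into a pseudometric
  \<open>\<rho>\<^sub>v\<close> on the vertices, which extends continuously to the boundary and depends on nothing but the
  graph and \<open>v\<close>. Take the coboundary of the antisymmetric cochain
  \<open>\<alpha>\<^sub>v\<^sub>w(\<xi>, \<eta>) = \<rho>\<^sub>v(\<xi>, \<eta>)\<^sup>K (\<rho>\<^sub>v(\<xi>, w) - \<rho>\<^sub>v(\<eta>, w))\<close>, weighted by \<open>\<lambda>\<close> to the power of the distance from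
  \<open>v\<close> to \<open>w\<close>, and let the origins of two edges play the roles of \<open>v\<close> and \<open>w\<close>. The Lipschitz
  dependence on the ideal points makes the coboundary at \<open>v\<close> decay like
  \<open>exp (- \<epsilon> (K s + t))\<close>, where \<open>s\<close> is the distance from \<open>v\<close> to the ideal tripod and \<open>t\<close> the distance
  from its projection to the centre. For large \<open>K\<close> this beats the growth of the graph transversally to
  the tripod, while along the three legs the decay in \<open>t\<close> suffices; the resulting \<open>\<ell>\<^sup>1\<close> bound is uniform.
  If the coboundary vanished at a triple, letting \<open>w\<close> tend to each of the three points would force
  their \<open>\<rho>\<^sub>v\<close>-distances to coincide for every \<open>v\<close>, which fails as \<open>v\<close> tends to one of them.
\<close>

section \<open>Chain pseudometrics\<close>

inductive chain :: "'a set \<Rightarrow> ('a \<Rightarrow> 'a \<Rightarrow> real) \<Rightarrow> nat \<Rightarrow> 'a \<Rightarrow> 'a \<Rightarrow> real \<Rightarrow> bool"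
  for V \<theta> where
  chain_refl: "x \<in> V \<Longrightarrow> chain V \<theta> 0 x x 0"
| chain_step: "chain V \<theta> n x y s \<Longrightarrow> z \<in> V \<Longrightarrow> chain V \<theta> (Suc n) x z (s + \<theta> y z)"

definition chain_dist :: "'a set \<Rightarrow> ('a \<Rightarrow> 'a \<Rightarrow> real) \<Rightarrow> 'a \<Rightarrow> 'a \<Rightarrow> real" where
  "chain_dist V \<theta> x y = Inf {s. \<exists>n. chain V \<theta> n x y s}"

lemma chain_in: "chain V \<theta> n x y s \<Longrightarrow> x \<in> V \<and> y \<in> V"
  by (induction rule: chain.induct) auto

lemma chain_0: "chain V \<theta> 0 x y s \<Longrightarrow> y = x \<and> s = 0"
  by (erule chain.cases) auto

lemma chain_trans: "chain V \<theta> m y z t \<Longrightarrow> chain V \<theta> n x y s \<Longrightarrow> chain V \<theta> (n + m) x z (s + t)"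
proof (induction rule: chain.induct)
  case (chain_step m y u t z)
  then show ?case using chain.chain_step[of V \<theta> "n + m" x u "s + t" z] by (simp add: add.assoc)
qed simp

lemma chain_single: "x \<in> V \<Longrightarrow> y \<in> V \<Longrightarrow> chain V \<theta> 1 x y (\<theta> x y)"
  using chain_step[OF chain_refl] by fastforce

lemma chain_sym:
  assumes "\<And>x y. x \<in> V \<Longrightarrow> y \<in> V \<Longrightarrow> \<theta> x y = \<theta> y x"
  shows "chain V \<theta> n x y s \<Longrightarrow> chain V \<theta> n y x s"
proof (induction rule: chain.induct)
  case (chain_step n x y s z)
  then show ?case
    using chain_trans[OF chain_step.IH chain_single[of z V y \<theta>]] assms chain_in
    by (fastforce simp: add.commute)
qed (rule chain_refl)

lemma chain_map:
  assumes "chain V \<theta> n x y s" "\<And>x. x \<in> V \<Longrightarrow> h x \<in> W"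
    "\<And>x y. x \<in> V \<Longrightarrow> y \<in> V \<Longrightarrow> \<theta>' (h x) (h y) = \<theta> x y"
  shows "chain W \<theta>' n (h x) (h y) s"
  using assms(1)
proof (induction rule: chain.induct)
  case (chain_step n x y s z)
  then show ?case
    using chain.chain_step[OF chain_step.IH, of "h z"] assms(2,3) chain_in by fastforce
qed (auto intro: chain_refl assms)

section \<open>The pseudometric generated by a symmetric weight, and Frink's metrization
  lemma\<close>

locale chain_weight =
  fixes V :: "'a set" and \<theta> :: "'a \<Rightarrow> 'a \<Rightarrow> real"
  assumes weight_nonneg: "\<theta> x y \<ge> 0"
    and weight_sym: "x \<in> V \<Longrightarrow> y \<in> V \<Longrightarrow> \<theta> x y = \<theta> y x"
begin

lemma chain_nonneg: "chain V \<theta> n x y s \<Longrightarrow> s \<ge> 0"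
  by (induction rule: chain.induct) (auto simp: weight_nonneg)

lemma chain_bdd: "bdd_below {s. \<exists>n. chain V \<theta> n x y s}"
  using chain_nonneg by (intro bdd_belowI[of _ 0]) blast

lemma chain_nonempty: "x \<in> V \<Longrightarrow> y \<in> V \<Longrightarrow> {s. \<exists>n. chain V \<theta> n x y s} \<noteq> {}"
  using chain_single by fastforce

lemma chain_dist_le: "chain V \<theta> n x y s \<Longrightarrow> chain_dist V \<theta> x y \<le> s"
  unfolding chain_dist_def by (rule cInf_lower[OF _ chain_bdd]) blast

lemma chain_dist_le_weight: "x \<in> V \<Longrightarrow> y \<in> V \<Longrightarrow> chain_dist V \<theta> x y \<le> \<theta> x y"
  by (rule chain_dist_le[OF chain_single])

lemma chain_dist_greatest:
  assumes "x \<in> V" "y \<in> V" "\<And>n s. chain V \<theta> n x y s \<Longrightarrow> c \<le> s"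
  shows "c \<le> chain_dist V \<theta> x y"
  unfolding chain_dist_def using assms(3) by (intro cInf_greatest[OF chain_nonempty[OF assms(1,2)]]) blast

lemma chain_dist_nonneg: "x \<in> V \<Longrightarrow> y \<in> V \<Longrightarrow> chain_dist V \<theta> x y \<ge> 0"
  by (rule chain_dist_greatest) (auto dest: chain_nonneg)

lemma chain_dist_refl: "x \<in> V \<Longrightarrow> chain_dist V \<theta> x x = 0"
  using chain_dist_le[OF chain_refl] chain_dist_nonneg by (metis order_antisym)

lemma chain_dist_sym:
  assumes "x \<in> V" "y \<in> V" shows "chain_dist V \<theta> x y = chain_dist V \<theta> y x"
proof -
  have "chain V \<theta> n x y s \<longleftrightarrow> chain V \<theta> n y x s" for n s
    using chain_sym[of V \<theta> n x y s] chain_sym[of V \<theta> n y x s] weight_sym by blast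
  then show ?thesis by (simp add: chain_dist_def)
qed

lemma chain_dist_approx:
  assumes "x \<in> V" "y \<in> V" "e > 0"
  shows "\<exists>n s. chain V \<theta> n x y s \<and> s < chain_dist V \<theta> x y + e"
proof (rule ccontr)
  assume "\<not> ?thesis"
  then have "chain_dist V \<theta> x y + e \<le> chain_dist V \<theta> x y"
    by (intro chain_dist_greatest assms) (auto simp: not_less)
  then show False using assms by simp
qed

lemma chain_dist_triangle:
  assumes "x \<in> V" "y \<in> V" "z \<in> V"
  shows "chain_dist V \<theta> x z \<le> chain_dist V \<theta> x y + chain_dist V \<theta> y z"
proof (rule field_le_epsilon)
  fix e :: real assume "e > 0"
  then have "e / 2 > 0" by simp
  then obtain n s m t where "chain V \<theta> n x y s" "s < chain_dist V \<theta> x y + e / 2"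
     "chain V \<theta> m y z t" "t < chain_dist V \<theta> y z + e / 2"
    using chain_dist_approx[OF assms(1,2)] chain_dist_approx[OF assms(2,3)] by blast
  moreover from this have "chain_dist V \<theta> x z \<le> s + t"
    by (intro chain_dist_le[OF chain_trans])
  ultimately show "chain_dist V \<theta> x z \<le> chain_dist V \<theta> x y + chain_dist V \<theta> y z + e" by simp
qed

text \<open>The middle step from \<open>u\<close> to \<open>w\<close> is the one at which the
  partial sums cross \<open>\<tau>\<close>. Both remaining pieces have fewer steps, which is what
  the induction in \<open>frink\<close> lives on.\<close>

lemma chain_split:
  assumes "chain V \<theta> n x y s" "0 < n" "0 \<le> \<tau>" "\<tau> \<le> s"
  shows "\<exists>m k u w a b. chain V \<theta> m x u a \<and> chain V \<theta> k w y b \<and> m < n \<and> k < n \<and>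
           a \<le> \<tau> \<and> b \<le> s - \<tau> \<and> a + \<theta> u w + b = s"
  using assms
proof (induction rule: chain.induct)
  case (chain_step n x y s z)
  show ?case
  proof (cases "\<tau> \<le> s \<and> 0 < n")
    case True
    then obtain m k u w a b where *: "chain V \<theta> m x u a" "chain V \<theta> k w y b" "m < n" "k < n"
           "a \<le> \<tau>" "b \<le> s - \<tau>" "a + \<theta> u w + b = s"
      using chain_step.IH chain_step.prems by blast
    show ?thesis
      using * chain.chain_step[OF *(2), of z] chain_step.hyps
      by (intro exI[of _ m] exI[of _ "Suc k"] exI[of _ u] exI[of _ w] exI[of _ a]
          exI[of _ "b + \<theta> y z"]) simp
  next
    case False
    \<comment> \<open>Either the sum before the last step is below \<open>\<tau>\<close>, or the
      chain before it is empty with sum 0. The last step is then the crossing one and nothing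
      follows it.\<close>
    then have "s \<le> \<tau>" using chain_step.hyps(1) chain_step.prems(2) by (auto dest: chain_0)
    then show ?thesis
      using chain_step.hyps chain_step.prems
      by (intro exI[of _ n] exI[of _ 0] exI[of _ y] exI[of _ z] exI[of _ s] exI[of _ 0])
         (simp add: chain_refl)
  qed
qed simp

text \<open>A chain is cut at half of its sum. By induction the weight across each half is at most
  \<open>2 * (s / 2) = s\<close>, the middle step has weight at most \<open>s\<close> as well, and
  joining the three by two uses of the quasi-ultrametric inequality costs
  \<open>K^2 \<le> 2\<close>.\<close>

lemma frink:
  assumes K: "K \<ge> 1" "K^2 \<le> 2"
    and quasi: "\<And>x y z. x \<in> V \<Longrightarrow> y \<in> V \<Longrightarrow> z \<in> V \<Longrightarrow> \<theta> x z \<le> K * max (\<theta> x y) (\<theta> y z)"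
  shows "chain V \<theta> n x y s \<Longrightarrow> n > 0 \<Longrightarrow> \<theta> x y \<le> 2 * s"
proof (induction n arbitrary: x y s rule: less_induct)
  case (less n)
  have s0: "s \<ge> 0" using chain_nonneg less.prems by blast
  have Ks: "K * s \<le> 2 * s"
  proof -
    have "K * 1 \<le> K * K" using K by (intro mult_left_mono) auto
    then have "K \<le> 2" using K unfolding power2_eq_square by linarith
    then show ?thesis using s0 by (rule mult_right_mono)
  qed
  have KKs: "K * (K * s) \<le> 2 * s"
    using mult_right_mono[OF K(2) s0] by (simp add: power2_eq_square mult.assoc)
  have sKs: "s \<le> K * s" using mult_right_mono[OF K(1) s0] by simp
  obtain m k u w a b where *: "chain V \<theta> m x u a" "chain V \<theta> k w y b" "m < n" "k < n"
           "a \<le> s / 2" "b \<le> s - s / 2" "a + \<theta> u w + b = s"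
    using chain_split[OF less.prems, of "s / 2"] s0 by auto
  have in_V: "x \<in> V" "u \<in> V" "w \<in> V" "y \<in> V" using chain_in[OF *(1)] chain_in[OF *(2)] by auto
  have ab: "a \<ge> 0" "b \<ge> 0" using chain_nonneg[OF *(1)] chain_nonneg[OF *(2)] by auto
  have uw: "\<theta> u w \<le> s" using * ab by simp
  \<comment> \<open>An empty half gives no bound on a weight, since that of a point with itself may
    be large. It is recorded as an equality and saves one use of \<open>quasi\<close>.\<close>
  have xu: "x = u \<or> \<theta> x u \<le> s"
    using less.IH[OF *(3) *(1)] *(1,5) by (cases "m = 0") (auto dest: chain_0)
  have wy: "y = w \<or> \<theta> w y \<le> s"
    using less.IH[OF *(4) *(2)] *(2,6) by (cases "k = 0") (auto dest: chain_0)
  have xw: "\<theta> x w \<le> K * s \<and> (x = u \<longrightarrow> \<theta> x w \<le> s)"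
  proof (cases "x = u")
    case False
    have "\<theta> x w \<le> K * max (\<theta> x u) (\<theta> u w)" by (rule quasi) (use in_V in auto)
    also have "\<dots> \<le> K * s" using xu uw False K by (intro mult_left_mono) auto
    finally show ?thesis using False by simp
  qed (use uw sKs in auto)
  show ?case
  proof (cases "y = w")
    case False
    have "\<theta> x y \<le> K * max (\<theta> x w) (\<theta> w y)" by (rule quasi) (use in_V in auto)
    also have "\<dots> \<le> K * (K * s)"
      using wy xw sKs False K by (intro mult_left_mono) auto
    finally show ?thesis using KKs by simp
  qed (use xw Ks in auto)
qed

text \<open>Distinct points are joined by nonempty chains only, so Frink's bound applies to every
  chain in the infimum. On the diagonal the distance is 0 while the weight may be positive.\<close>

lemma weight_le_chain_dist:
  assumes K: "K \<ge> 1" "K^2 \<le> 2"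
    and quasi: "\<And>x y z. x \<in> V \<Longrightarrow> y \<in> V \<Longrightarrow> z \<in> V \<Longrightarrow> \<theta> x z \<le> K * max (\<theta> x y) (\<theta> y z)"
    and xy: "x \<in> V" "y \<in> V" "x \<noteq> y"
  shows "\<theta> x y \<le> 2 * chain_dist V \<theta> x y"
proof -
  have "\<theta> x y / 2 \<le> chain_dist V \<theta> x y"
  proof (rule chain_dist_greatest[OF xy(1,2)])
    fix n s assume *: "chain V \<theta> n x y s"
    then have "n > 0" using chain_0 xy(3) by (metis neq0_conv)
    then show "\<theta> x y / 2 \<le> s" using frink[OF K quasi *] by simp
  qed
  then show ?thesis by simp
qed

end

text \<open>Two weights occur because an automorphism of the graph also moves the base point on
  which the weight depends.\<close>

lemma chain_dist_map:
  assumes "bij_betw h V V" "\<And>x y. x \<in> V \<Longrightarrow> y \<in> V \<Longrightarrow> \<theta>' (h x) (h y) = \<theta> x y" "x \<in> V" "y \<in> V"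
  shows "chain_dist V \<theta>' (h x) (h y) = chain_dist V \<theta> x y"
proof -
  let ?k = "inv_into V h"
  have k: "?k z \<in> V" "h (?k z) = z" if "z \<in> V" for z
    using that assms(1) by (auto simp: bij_betw_def inv_into_into f_inv_into_f)
  have kh: "?k (h z) = z" if "z \<in> V" for z
    using that assms(1) by (simp add: bij_betw_def)
  have "chain V \<theta>' n (h x) (h y) s \<longleftrightarrow> chain V \<theta> n x y s" for n s
  proof
    assume *: "chain V \<theta>' n (h x) (h y) s"
    have "\<theta> (?k a) (?k b) = \<theta>' a b" if "a \<in> V" "b \<in> V" for a b
      using assms(2)[OF k(1)[OF that(1)] k(1)[OF that(2)]] k(2) that by simp
    then have "chain V \<theta> n (?k (h x)) (?k (h y)) s"
      using chain_map[OF *, of ?k V \<theta>] k(1) by blast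
    then show "chain V \<theta> n x y s" by (simp add: kh assms(3,4))
  next
    assume *: "chain V \<theta> n x y s"
    have "h a \<in> V" if "a \<in> V" for a using that assms(1) by (auto simp: bij_betw_def)
    then show "chain V \<theta>' n (h x) (h y) s"
      using chain_map[OF *, of h V \<theta>'] assms(2) by blast
  qed
  then show ?thesis by (simp add: chain_dist_def)
qed

section \<open>The path metric\<close>

locale bounded_serre_graph = bidirected_digraph G arev
  for G :: "('v, 'e) pre_digraph" and arev :: "'e \<Rightarrow> 'e" +
  fixes N :: nat
  assumes connected: "Digraph_Component.connected G"
    and finite_out: "v \<in> verts G \<Longrightarrow> finite (out_arcs G v)"
    and card_out: "v \<in> verts G \<Longrightarrow> card (out_arcs G v) \<le> N"
begin

abbreviation "V \<equiv> verts G"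
abbreviation "D \<equiv> graph_dist G"

lemma ex_awalk:
  assumes "u \<in> V" "v \<in> V" shows "\<exists>p. awalk u p v"
proof -
  have "strongly_connected G"
    using symmetric_connected_imp_strongly_connected connected sym_arcs by blast
  then show ?thesis using assms reachable_awalk by (auto simp: strongly_connected_def)
qed

lemma dist_le: "awalk u p v \<Longrightarrow> D u v \<le> length p"
  unfolding graph_dist_def by (intro cInf_lower) auto

lemma dist_attained:
  assumes "u \<in> V" "v \<in> V" obtains p where "awalk u p v" "length p = D u v"
proof -
  have "length ` {p. awalk u p v} \<noteq> {}" using ex_awalk[OF assms] by auto
  from Inf_nat_def1[OF this] have "D u v \<in> length ` {p. awalk u p v}"
    by (simp add: graph_dist_def)
  then show ?thesis using that by auto
qed

lemma dist_refl: "u \<in> V \<Longrightarrow> D u u = 0"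
  using dist_le[of u "[]" u] by (simp add: awalk_Nil_iff)

lemma dist_0: "u \<in> V \<Longrightarrow> v \<in> V \<Longrightarrow> D u v = 0 \<Longrightarrow> u = v"
  by (rule dist_attained[of u v]) (auto simp: awalk_Nil_iff)

lemma awalk_reverse: "awalk u p v \<Longrightarrow> awalk v (rev (map arev p)) u"
proof (induction p arbitrary: u)
  case (Cons e p)
  then have e: "e \<in> arcs G" "u = tail G e" "awalk (head G e) p v" by (auto simp: awalk_Cons_iff)
  have "awalk (head G e) [arev e] u" using e by (simp add: awalk_Cons_iff awalk_Nil_iff)
  then show ?case using awalk_appendI[OF Cons.IH[OF e(3)]] by simp
qed (auto simp: awalk_Nil_iff)

lemma dist_sym:
  assumes "u \<in> V" "v \<in> V" shows "D u v = D v u"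
proof -
  have "D b a \<le> D a b" if "a \<in> V" "b \<in> V" for a b
    using dist_attained[OF that] dist_le[OF awalk_reverse] by (metis length_map length_rev)
  then show ?thesis using assms by (meson order_antisym)
qed

lemma dist_triangle:
  assumes "u \<in> V" "v \<in> V" "w \<in> V" shows "D u w \<le> D u v + D v w"
proof -
  obtain p q where "awalk u p v" "length p = D u v" "awalk v q w" "length q = D v w"
    using dist_attained assms by metis
  then show ?thesis using dist_le[OF awalk_appendI] by (metis length_append)
qed

text \<open>A shortest walk is cut after \<open>j\<close> arcs. The pieces add up to
  \<open>D u v\<close>, so the triangle inequality forces both distance bounds to be
  equalities.\<close>

lemma ex_dist_split:
  assumes "u \<in> V" "v \<in> V" "j \<le> D u v"
  obtains g where "g \<in> V" "D u g = j" "D g v = D u v - j"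
proof -
  obtain p where p: "awalk u p v" "length p = D u v" using dist_attained assms(1,2) .
  then have "awalk u (take j p @ drop j p) v" by simp
  then obtain g where g: "awalk u (take j p) g" "awalk g (drop j p) v"
    unfolding awalk_append_iff by blast
  have gV: "g \<in> V" using g(1) by (rule awalk_last_in_verts)
  have "D u g \<le> j" "D g v \<le> D u v - j"
    using dist_le[OF g(1)] dist_le[OF g(2)] p(2) assms(3) by auto
  moreover have "D u v \<le> D u g + D g v" using dist_triangle assms gV by blast
  ultimately show ?thesis using that[OF gV] assms(3) by linarith
qed

section \<open>Volume growth and a summable weight on the vertices\<close>

lemma sphere_bound:
  assumes g: "g \<in> V"
  shows "finite {v \<in> V. D g v = n} \<and> card {v \<in> V. D g v = n} \<le> N ^ n"
proof (induction n)
  case 0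
  have *: "{v \<in> V. D g v = 0} \<subseteq> {g}" using dist_0 g by blast
  show ?case using card_mono[OF _ *] finite_subset[OF *] by simp
next
  case (Suc n)
  let ?S = "{v \<in> V. D g v = n}"
  let ?U = "\<Union>w\<in>?S. head G ` out_arcs G w"
  have "{v \<in> V. D g v = Suc n} \<subseteq> ?U"
  proof
    fix v assume v: "v \<in> {v \<in> V. D g v = Suc n}"
    then obtain w where w: "w \<in> V" "D g w = n" "D w v = Suc 0"
      using ex_dist_split[of g v n] g by (auto simp: Suc_diff_le)
    obtain p where p: "awalk w p v" "length p = D w v" using dist_attained w v by blast
    then obtain e where "p = [e]" using w(3) by (metis length_0_conv length_Suc_conv)
    then have "e \<in> out_arcs G w" "v = head G e"
      using p(1) by (auto simp: awalk_Cons_iff awalk_Nil_iff)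
    then show "v \<in> ?U" using w by blast
  qed
  moreover have "finite ?U" using Suc finite_out by auto
  moreover have "card ?U \<le> N ^ Suc n"
  proof -
    have "card ?U \<le> (\<Sum>w\<in>?S. card (head G ` out_arcs G w))" using Suc by (intro card_UN_le) auto
    also have "\<dots> \<le> (\<Sum>w\<in>?S. N)"
      using card_image_le[OF finite_out] card_out by (intro sum_mono) (fastforce intro: order_trans)
    also have "\<dots> \<le> N ^ Suc n" using Suc by simp
    finally show ?thesis .
  qed
  ultimately show ?case by (meson card_mono finite_subset order_trans)
qed

text \<open>Chosen so that \<open>N * lam \<le> 1/2\<close>: then \<open>lam ^ n\<close> beats the
  growth \<open>N ^ n\<close> of spheres by a geometric factor. The summand 1 keeps
  \<open>lam\<close> positive when \<open>N = 0\<close>.\<close>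

definition lam :: real where "lam = 1 / (2 * (real N + 1))"

lemma lam_pos: "0 < lam" and lam_N: "real N * lam \<le> 1 / 2"
  by (auto simp: lam_def divide_simps)

lemma sum_lam_le:
  assumes "g \<in> V" "finite A" "A \<subseteq> V"
  shows "(\<Sum>v\<in>A. lam ^ D g v) \<le> 2"
proof -
  define m where "m = Max (insert 0 (D g ` A))"
  have "(\<Sum>v\<in>A. lam ^ D g v) = (\<Sum>n\<le>m. \<Sum>v\<in>{v \<in> A. D g v = n}. lam ^ D g v)"
    by (rule sum.group[symmetric]) (use assms in \<open>auto simp: m_def\<close>)
  also have "\<dots> = (\<Sum>n\<le>m. real (card {v \<in> A. D g v = n}) * lam ^ n)"
    by (intro sum.cong refl) simp
  also have "\<dots> \<le> (\<Sum>n\<le>m. (1/2) ^ n)"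
  proof (intro sum_mono)
    fix n
    have "card {v \<in> A. D g v = n} \<le> card {v \<in> V. D g v = n}"
      using sphere_bound[OF assms(1)] assms by (intro card_mono) auto
    also have "\<dots> \<le> N ^ n" using sphere_bound[OF assms(1)] by simp
    finally have "real (card {v \<in> A. D g v = n}) * lam ^ n \<le> real (N ^ n) * lam ^ n"
      using lam_pos by (intro mult_right_mono) (simp_all only: of_nat_le_iff, simp)
    also have "\<dots> = (real N * lam) ^ n" by (simp add: power_mult_distrib)
    also have "\<dots> \<le> (1/2) ^ n" using lam_N lam_pos by (intro power_mono) auto
    finally show "real (card {v \<in> A. D g v = n}) * lam ^ n \<le> (1/2) ^ n" .
  qed
  also have "\<dots> \<le> (\<Sum>n. (1/2) ^ n)" by (intro sum_le_suminf) (auto intro: summable_geometric)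
  also have "\<dots> = 2" by (simp add: suminf_geometric)
  finally show ?thesis .
qed

section \<open>Automorphisms act by isometries\<close>

lemma awalk_map:
  assumes "\<And>v. v \<in> V \<Longrightarrow> \<phi> v \<in> V" "\<And>e. e \<in> arcs G \<Longrightarrow> \<psi> e \<in> arcs G"
    "\<And>e. e \<in> arcs G \<Longrightarrow> tail G (\<psi> e) = \<phi> (tail G e)"
    "\<And>e. e \<in> arcs G \<Longrightarrow> head G (\<psi> e) = \<phi> (head G e)"
  shows "awalk u p v \<Longrightarrow> awalk (\<phi> u) (map \<psi> p) (\<phi> v)"
proof (induction p arbitrary: u)
  case (Cons e p)
  then show ?case using assms by (auto simp: awalk_Cons_iff)
qed (auto simp: awalk_Nil_iff assms)

lemma dist_map_le:
  assumes "\<And>v. v \<in> V \<Longrightarrow> \<phi> v \<in> V" "\<And>e. e \<in> arcs G \<Longrightarrow> \<psi> e \<in> arcs G"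
    "\<And>e. e \<in> arcs G \<Longrightarrow> tail G (\<psi> e) = \<phi> (tail G e)"
    "\<And>e. e \<in> arcs G \<Longrightarrow> head G (\<psi> e) = \<phi> (head G e)"
    and uv: "u \<in> V" "v \<in> V"
  shows "D (\<phi> u) (\<phi> v) \<le> D u v"
proof -
  obtain p where "awalk u p v" "length p = D u v" using dist_attained uv .
  then show ?thesis using dist_le[OF awalk_map[of \<phi> \<psi> u p v]] assms by simp
qed

lemma dist_automorphism:
  assumes "graph_automorphism G arev \<phi> \<psi>" and uv: "u \<in> V" "v \<in> V"
  shows "D (\<phi> u) (\<phi> v) = D u v"
proof (rule order_antisym)
  have bij: "bij_betw \<phi> V V" "bij_betw \<psi> (arcs G) (arcs G)"
    and ends: "\<And>e. e \<in> arcs G \<Longrightarrow> tail G (\<psi> e) = \<phi> (tail G e)"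
      "\<And>e. e \<in> arcs G \<Longrightarrow> head G (\<psi> e) = \<phi> (head G e)"
    using assms(1) by (auto simp: graph_automorphism_def)
  note in_V = bij_betw_apply[OF bij(1)] and in_E = bij_betw_apply[OF bij(2)]
  show "D (\<phi> u) (\<phi> v) \<le> D u v"
    using dist_map_le[of \<phi> \<psi>] in_V in_E ends uv by blast
  let ?\<phi> = "inv_into V \<phi>" and ?\<psi> = "inv_into (arcs G) \<psi>"
  note bij' = bij_betw_inv_into[OF bij(1)] bij_betw_inv_into[OF bij(2)]
  have inv: "?\<phi> (\<phi> x) = x" if "x \<in> V" for x using that bij(1) by (simp add: bij_betw_def)
  have \<psi>: "?\<psi> e \<in> arcs G" "\<psi> (?\<psi> e) = e" if "e \<in> arcs G" for e
    using that bij(2) bij_betw_apply[OF bij'(2)] by (auto simp: bij_betw_inv_into_right)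
  have "tail G (?\<psi> e) = ?\<phi> (tail G e)" "head G (?\<psi> e) = ?\<phi> (head G e)" if "e \<in> arcs G" for e
    using ends[OF \<psi>(1)[OF that]] \<psi>[OF that] inv by auto
  then have "D (?\<phi> (\<phi> u)) (?\<phi> (\<phi> v)) \<le> D (\<phi> u) (\<phi> v)"
    using dist_map_le[of ?\<phi> ?\<psi>] bij_betw_apply[OF bij'(1)] \<psi>(1) in_V uv by blast
  then show "D u v \<le> D (\<phi> u) (\<phi> v)" using inv uv by simp
qed

end

section \<open>Visual metrics and the main estimate\<close>

text \<open>The coboundary, in \<open>x\<close>, \<open>y\<close>, \<open>z\<close>, of the cochain
  \<open>d x y ^ K * (d x w - d y w)\<close> with parameter \<open>w\<close>; for symmetric
  \<open>d\<close> this cochain is antisymmetric.\<close>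

definition cyc :: "nat \<Rightarrow> ('a \<Rightarrow> 'a \<Rightarrow> real) \<Rightarrow> 'a \<Rightarrow> 'a \<Rightarrow> 'a \<Rightarrow> 'a \<Rightarrow> real" where
  "cyc K d x y z w = d x y ^ K * (d x w - d y w) + d y z ^ K * (d y w - d z w)
     + d z x ^ K * (d z w - d x w)"

lemma cyc_rotate: "cyc K d x y z w = cyc K d y z x w"
  by (simp add: cyc_def)

text \<open>The mean value estimate for powers, multiplied by \<open>M\<close> to avoid the exponent
  \<open>K - 1\<close> and a division by an \<open>M\<close> that may be 0.\<close>

lemma abs_power_diff_le:
  fixes p q M :: real
  assumes "0 \<le> p" "p \<le> M" "0 \<le> q" "q \<le> M"
  shows "\<bar>p ^ K - q ^ K\<bar> * M \<le> K * M ^ K * \<bar>p - q\<bar>"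
proof (induction K)
  case (Suc K)
  have "p ^ Suc K - q ^ Suc K = p * (p ^ K - q ^ K) + (p - q) * q ^ K" by (simp add: algebra_simps)
  then have "\<bar>p ^ Suc K - q ^ Suc K\<bar> \<le> p * \<bar>p ^ K - q ^ K\<bar> + \<bar>p - q\<bar> * q ^ K"
    using assms by (metis abs_mult abs_of_nonneg abs_triangle_ineq zero_le_power)
  then have "\<bar>p ^ Suc K - q ^ Suc K\<bar> * M \<le> (p * \<bar>p ^ K - q ^ K\<bar> + \<bar>p - q\<bar> * q ^ K) * M"
    using assms by (intro mult_right_mono) auto
  also have "\<dots> = p * (\<bar>p ^ K - q ^ K\<bar> * M) + \<bar>p - q\<bar> * M * q ^ K" by (simp add: algebra_simps)
  also have "\<dots> \<le> M * (K * M ^ K * \<bar>p - q\<bar>) + \<bar>p - q\<bar> * M * M ^ K"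
    using assms Suc
    by (intro add_mono mult_mono[OF assms(2) Suc] mult_left_mono power_mono) (auto intro: mult_nonneg_nonneg)
  also have "\<dots> = Suc K * M ^ Suc K * \<bar>p - q\<bar>" by (simp add: algebra_simps)
  finally show ?case .
qed simp

text \<open>The three differences in \<open>w\<close> add up to 0, so \<open>d z x ^ K\<close> can
  be subtracted from all three coefficients. In each of the two remaining terms one factor is
  bounded by means of \<open>d y z\<close>: a difference of powers by the triangle inequality, or a
  difference in \<open>w\<close> by the Lipschitz bound.\<close>

lemma cyc_bound:
  fixes d :: "'a \<Rightarrow> 'a \<Rightarrow> real"
  assumes nonneg: "0 \<le> d x y" "0 \<le> d y z" "0 \<le> d z x"
    and le: "d x y \<le> M" "d y z \<le> M" "d z x \<le> M"
    and lip: "\<bar>d x w - d y w\<bar> \<le> d x y" "\<bar>d y w - d z w\<bar> \<le> d y z"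
    and tri: "\<bar>d x y - d z x\<bar> \<le> d y z"
  shows "\<bar>cyc K d x y z w\<bar> \<le> real (K + 1) * M ^ K * d y z"
proof -
  let ?p = "d x y" and ?r = "d y z" and ?q = "d z x"
  have eq: "cyc K d x y z w = (?p ^ K - ?q ^ K) * (d x w - d y w) + (?r ^ K - ?q ^ K) * (d y w - d z w)"
    by (simp add: cyc_def algebra_simps)
  have 1: "\<bar>(?p ^ K - ?q ^ K) * (d x w - d y w)\<bar> \<le> K * M ^ K * ?r"
  proof -
    have "\<bar>(?p ^ K - ?q ^ K) * (d x w - d y w)\<bar> \<le> \<bar>?p ^ K - ?q ^ K\<bar> * M"
      unfolding abs_mult using lip le by (intro mult_left_mono) auto
    also have "\<dots> \<le> K * M ^ K * \<bar>?p - ?q\<bar>" using nonneg le by (intro abs_power_diff_le)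
    also have "\<dots> \<le> K * M ^ K * ?r" using tri nonneg le by (intro mult_left_mono) auto
    finally show ?thesis .
  qed
  have 2: "\<bar>(?r ^ K - ?q ^ K) * (d y w - d z w)\<bar> \<le> M ^ K * ?r"
  proof -
    have "0 \<le> ?r ^ K" "?r ^ K \<le> M ^ K" "0 \<le> ?q ^ K" "?q ^ K \<le> M ^ K"
      using nonneg le by (auto intro: power_mono)
    then have "\<bar>?r ^ K - ?q ^ K\<bar> \<le> M ^ K" by linarith
    then show ?thesis unfolding abs_mult using lip nonneg by (intro mult_mono) auto
  qed
  show ?thesis
    using 1 2 abs_triangle_ineq[of "(?p ^ K - ?q ^ K) * (d x w - d y w)" "(?r ^ K - ?q ^ K) * (d y w - d z w)"]
    unfolding eq by (simp add: algebra_simps)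
qed

locale hyperbolic_serre_graph = bounded_serre_graph G arev N
  for G :: "('v, 'e) pre_digraph" and arev N +
  fixes \<delta> :: real
  assumes \<delta>_nonneg: "\<delta> \<ge> 0"
    and hyperbolic: "\<lbrakk>x \<in> verts G; y \<in> verts G; z \<in> verts G; b \<in> verts G\<rbrakk> \<Longrightarrow>
      gromov_product G b x z \<ge> min (gromov_product G b x y) (gromov_product G b y z) - \<delta>"
begin

abbreviation "gp \<equiv> gromov_product G"

lemma gp_sym: "x \<in> V \<Longrightarrow> y \<in> V \<Longrightarrow> gp b x y = gp b y x"
  by (simp add: gromov_product_def dist_sym[of x y])

lemma gp_nonneg: "b \<in> V \<Longrightarrow> x \<in> V \<Longrightarrow> y \<in> V \<Longrightarrow> 0 \<le> gp b x y"
  using dist_triangle[of x b y] dist_sym[of b y] by (simp add: gromov_product_def)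

lemma gp_le_dist: "b \<in> V \<Longrightarrow> x \<in> V \<Longrightarrow> y \<in> V \<Longrightarrow> gp b x y \<le> D x b"
  using dist_triangle[of y x b] dist_sym[of x y] by (simp add: gromov_product_def)

lemma gp_base_change:
  assumes "b \<in> V" "c \<in> V" "x \<in> V" "y \<in> V"
  shows "gp b x y \<le> gp c x y + D b c"
proof -
  have "D x b \<le> D x c + D b c" "D y b \<le> D y c + D b c"
    using dist_triangle[of x c b] dist_triangle[of y c b] dist_sym[of b c] assms by auto
  then have "real (D x b) \<le> real (D x c) + D b c" "real (D y b) \<le> real (D y c) + D b c"
    by simp_all
  then show ?thesis unfolding gromov_product_def by argo
qed

text \<open>Gromov's inequality doubled, with the common distances to \<open>b\<close> cancelled;
  this form is symmetric in the four points.\<close>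

lemma four_point:
  assumes "x \<in> V" "y \<in> V" "z \<in> V" "b \<in> V"
  shows "real (D x z) + D y b \<le> max (real (D x y) + D z b) (real (D y z) + D x b) + 2 * \<delta>"
  using hyperbolic[OF assms] by (auto simp: gromov_product_def min_def max_def field_simps split: if_splits)

text \<open>The scale at which \<open>exp (eps * \<delta>) ^ 2 \<le> 2\<close>, as Frink's lemma
  requires; \<open>\<delta> + 1\<close> avoids a zero denominator.\<close>

definition eps :: real where "eps = ln 2 / (2 * (\<delta> + 1))"

lemma eps_pos: "eps > 0"
  using \<delta>_nonneg by (simp add: eps_def)

lemma exp_eps_\<delta>: "exp (eps * \<delta>) ^ 2 \<le> 2"
proof -
  have "2 * eps * \<delta> \<le> ln 2"
    using \<delta>_nonneg by (simp add: eps_def field_simps mult_left_mono)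
  then have "exp (2 * eps * \<delta>) \<le> exp (ln 2)" by (simp only: exp_le_cancel_iff)
  then show ?thesis by (simp add: exp_of_nat_mult[symmetric] mult.assoc)
qed

section \<open>Visual weights and their pseudometrics\<close>

definition vis_weight :: "'v \<Rightarrow> 'v \<Rightarrow> 'v \<Rightarrow> real" where
  "vis_weight b x y = exp (- eps * gp b x y)"

definition vis_dist :: "'v \<Rightarrow> 'v \<Rightarrow> 'v \<Rightarrow> real" where
  "vis_dist b = chain_dist V (vis_weight b)"

sublocale vis: chain_weight V "vis_weight b" for b
  by unfold_locales (auto simp: vis_weight_def gp_sym)

lemmas vis_dist_nonneg = vis.chain_dist_nonneg[of _ _ b for b, folded vis_dist_def]
lemmas vis_dist_refl = vis.chain_dist_refl[of _ b for b, folded vis_dist_def]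
lemmas vis_dist_sym = vis.chain_dist_sym[of _ _ b for b, folded vis_dist_def]
lemmas vis_dist_triangle = vis.chain_dist_triangle[of _ _ _ b for b, folded vis_dist_def]
lemmas vis_dist_le_weight = vis.chain_dist_le_weight[of _ _ b for b, folded vis_dist_def]

text \<open>Exponentiation turns a minimum up to an additive \<open>\<delta>\<close> into a maximum
  up to the factor \<open>exp (eps * \<delta>)\<close>.\<close>

lemma vis_weight_quasi:
  assumes "b \<in> V" "x \<in> V" "y \<in> V" "z \<in> V"
  shows "vis_weight b x z \<le> exp (eps * \<delta>) * max (vis_weight b x y) (vis_weight b y z)"
proof -
  have *: "- eps * gp b x z \<le> eps * \<delta> + - eps * min (gp b x y) (gp b y z)"
    using mult_left_mono[OF hyperbolic[OF assms(2,3,4,1)], of eps] eps_pos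
    by (simp add: algebra_simps)
  have "vis_weight b x z \<le> exp (eps * \<delta>) * exp (- eps * min (gp b x y) (gp b y z))"
    using * unfolding vis_weight_def exp_add[symmetric] by (simp only: exp_le_cancel_iff)
  also have "exp (- eps * min (gp b x y) (gp b y z)) = max (vis_weight b x y) (vis_weight b y z)"
    using eps_pos by (auto simp: vis_weight_def min_def max_def)
  finally show ?thesis .
qed

lemma weight_le_vis_dist:
  assumes "b \<in> V" "x \<in> V" "y \<in> V" "x \<noteq> y"
  shows "vis_weight b x y \<le> 2 * vis_dist b x y"
  unfolding vis_dist_def
  by (rule vis.weight_le_chain_dist[of "exp (eps * \<delta>)"])
     (use assms exp_eps_\<delta> eps_pos \<delta>_nonneg vis_weight_quasi in auto)

lemma vis_dist_lipschitz:
  assumes "x \<in> V" "y \<in> V" "w \<in> V"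
  shows "\<bar>vis_dist b x w - vis_dist b y w\<bar> \<le> vis_dist b x y"
  using vis_dist_triangle[of x y w b] vis_dist_triangle[of y x w b] vis_dist_sym[of x y b] assms
  by auto

text \<open>The power \<open>K\<close> of the cochain. It makes
  \<open>exp (- eps * expo) \<le> lam\<close>, so one step away from the tripod gains enough to
  absorb the growth of the graph.\<close>

definition expo :: nat where "expo = nat \<lceil>ln (2 * (real N + 1)) / eps\<rceil>"

lemma exp_expo: "exp (- eps * expo) \<le> lam"
proof -
  have "ln (2 * (real N + 1)) / eps \<le> real expo" unfolding expo_def by (rule real_nat_ceiling_ge)
  then have "ln (2 * (real N + 1)) \<le> eps * expo" using eps_pos by (simp add: field_simps)
  then have "exp (- eps * expo) \<le> exp (- ln (2 * (real N + 1)))" by simp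
  also have "\<dots> = lam" by (simp add: exp_minus lam_def inverse_eq_divide)
  finally show ?thesis .
qed

section \<open>Decay away from the tripod\<close>

definition gmin :: "'v \<Rightarrow> 'v \<Rightarrow> 'v \<Rightarrow> 'v \<Rightarrow> real" where
  "gmin b x y z = min (gp b x y) (min (gp b y z) (gp b z x))"

definition gmax :: "'v \<Rightarrow> 'v \<Rightarrow> 'v \<Rightarrow> 'v \<Rightarrow> real" where
  "gmax b x y z = max (gp b x y) (max (gp b y z) (gp b z x))"

text \<open>In a tree, if \<open>b\<close> is at distance s from the tripod of \<open>x\<close>,
  \<open>y\<close>, \<open>z\<close> and projects to a point at distance t from its centre, the
  three products are s, s and s + t. The exponent is then \<open>- eps\<close> times
  \<open>expo * s + s + t\<close>.\<close>

definition tripod :: "'v \<Rightarrow> 'v \<Rightarrow> 'v \<Rightarrow> 'v \<Rightarrow> real" where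
  "tripod b x y z = exp (- eps * (expo * gmin b x y z + gmax b x y z))"

lemma tripod_rotate: "tripod b x y z = tripod b y z x"
  by (simp add: tripod_def gmin_def gmax_def min.assoc min.commute min.left_commute
      max.assoc max.commute max.left_commute)

lemma cyc_vis_dist_le:
  assumes b: "b \<in> V" "w \<in> V" and xyz: "x \<in> V" "y \<in> V" "z \<in> V"
  shows "\<bar>cyc expo (vis_dist b) x y z w\<bar> \<le> real (expo + 1) * tripod b x y z"
proof -
  \<comment> \<open>Both sides are invariant under rotation, so (y|z)_b may be taken as the largest
    product. All three distances are at most \<open>?M\<close>, and \<open>vis_dist b y z\<close>
    contributes the factor belonging to \<open>gmax\<close>.\<close>
  have *: "\<bar>cyc expo (vis_dist b) x y z w\<bar> \<le> real (expo + 1) * tripod b x y z"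
    if "x \<in> V" "y \<in> V" "z \<in> V" and max: "gp b x y \<le> gp b y z" "gp b z x \<le> gp b y z" for x y z
  proof -
    let ?M = "exp (- eps * gmin b x y z)"
    have le: "vis_dist b u v \<le> ?M" if "u \<in> V" "v \<in> V" "gmin b x y z \<le> gp b u v" for u v
    proof -
      have "vis_dist b u v \<le> exp (- eps * gp b u v)"
        using vis_dist_le_weight that by (simp add: vis_weight_def)
      also have "\<dots> \<le> ?M" using eps_pos that by simp
      finally show ?thesis .
    qed
    have gmin: "gmin b x y z \<le> gp b x y" "gmin b x y z \<le> gp b y z" "gmin b x y z \<le> gp b z x"
      by (auto simp: gmin_def)
    have "\<bar>cyc expo (vis_dist b) x y z w\<bar> \<le> real (expo + 1) * ?M ^ expo * vis_dist b y z"
    proof (rule cyc_bound)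
      show "\<bar>vis_dist b x y - vis_dist b z x\<bar> \<le> vis_dist b y z"
        using vis_dist_lipschitz[of y z x b] vis_dist_sym[of x y b] that by simp
    qed (use that b le[OF _ _ gmin(1)] le[OF _ _ gmin(2)] le[OF _ _ gmin(3)]
        in \<open>auto intro: vis_dist_nonneg vis_dist_lipschitz\<close>)
    also have "\<dots> \<le> real (expo + 1) * ?M ^ expo * exp (- eps * gp b y z)"
      using vis_dist_le_weight[of y z b] that
      by (intro mult_left_mono) (auto simp: vis_weight_def)
    also have "\<dots> = real (expo + 1) * tripod b x y z"
      using max by (simp add: tripod_def gmax_def exp_of_nat_mult[symmetric] mult_exp_exp algebra_simps)
    finally show ?thesis .
  qed
  have "\<bar>cyc expo (vis_dist b) x y z w\<bar> = \<bar>cyc expo (vis_dist b) y z x w\<bar>"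
       "\<bar>cyc expo (vis_dist b) x y z w\<bar> = \<bar>cyc expo (vis_dist b) z x y w\<bar>"
       "tripod b x y z = tripod b y z x" "tripod b x y z = tripod b z x y"
    using cyc_rotate tripod_rotate by metis+
  then show ?thesis using *[of x y z] *[of y z x] *[of z x y] xyz by (auto simp: not_le) linarith
qed

text \<open>Absorbs the additive errors of the projection estimate: \<open>3 * \<delta> + 1\<close>
  in the distance to the tripod, multiplied by \<open>expo\<close>, and 1 in the position along the
  leg.\<close>

definition tripod_const :: real where
  "tripod_const = exp (eps * (expo * (3 * \<delta> + 1) + 1))"

text \<open>If \<open>(y|z)\<^sub>v\<close> is the largest of the three products, then \<open>v\<close> projects to the leg of the
  tripod that ends at \<open>x\<close>; \<open>g\<close> is the projection, and its distance to the centre is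
  \<open>(y|z)\<^sub>x - j\<close>.\<close>

lemma tripod_le_projection:
  assumes V: "v \<in> V" "x \<in> V" "y \<in> V" "z \<in> V"
    and max: "gp v x y \<le> gp v y z" "gp v z x \<le> gp v y z"
  obtains j where "real j \<le> gp x y z"
    "\<And>g. \<lbrakk>g \<in> V; D x g = j; D g y = D x y - j\<rbrakk> \<Longrightarrow>
       tripod v x y z \<le> tripod_const * (lam ^ D g v * exp (- eps * (gp x y z - j)))"
proof -
  \<comment> \<open>In a tree (v|y)_x is the distance from \<open>x\<close> to the projection of
    \<open>v\<close>; rounding down makes it the position of a vertex, with an error below
    1.\<close>
  define j where "j = nat \<lfloor>gp x v y\<rfloor>"
  have "0 \<le> gp x v y" using gp_nonneg V by blast
  then have j: "real j \<le> gp x v y" "gp x v y < real j + 1" by (auto simp: j_def)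
  have D_sym: "D x v = D v x" "D y v = D v y" "D z v = D v z" "D y x = D x y" "D z x = D x z"
    using dist_sym V by auto
  \<comment> \<open>By this identity, maximality of (y|z)_v means (v|y)_x \<le> (y|z)_x: the
    projection does not lie beyond the centre.\<close>
  have shift: "gp v y z = gp v z x + gp x y z - gp x v y"
    unfolding gromov_product_def using D_sym by (simp add: field_simps)
  have split: "D v x = gp v x y + gp x v y" "D v y = gp v x y + D x y - gp x v y"
    unfolding gromov_product_def using D_sym by (simp_all add: field_simps)
  have jP: "real j \<le> gp x y z" using shift max j by linarith
  have "gp x v y \<le> D x y" using gp_le_dist[of x y v] gp_sym[of v y x] V D_sym by simp
  then have jD: "j \<le> D x y" using j by linarith
  show ?thesis
  proof (rule that[OF jP])
    fix g assume g: "g \<in> V" "D x g = j" "D g y = D x y - j"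
    \<comment> \<open>Up to the rounding of \<open>j\<close>, both terms of the maximum equal
      \<open>D x y\<close> plus (x|y)_v, which leaves a bound on \<open>D v g\<close>.\<close>
    have "real (D v g) + D x y \<le> max (real (D v x) + D g y) (real (D x g) + D v y) + 2 * \<delta>"
      using four_point[of v x g y] V g by simp
    moreover have "real (D g y) = real (D x y) - j" using g jD by (simp add: of_nat_diff)
    ultimately have vg: "real (D v g) \<le> gp v x y + 2 * \<delta> + 1"
      using split j g(2) by (simp add: max_def split: if_splits)
    \<comment> \<open>As (y|z)_v is the largest product, Gromov's inequality through
      \<open>y\<close> prevents (z|x)_v from dropping more than \<open>\<delta>\<close> below
      (x|y)_v.\<close>
    have "gp v z x \<ge> gp v x y - \<delta>"
      using hyperbolic[of x y z v] max V gp_sym[of z x v] by (simp add: min_def split: if_splits)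
    then have "gmin v x y z \<ge> gp v x y - \<delta>"
      using max \<delta>_nonneg by (simp add: gmin_def)
    then have "gmin v x y z \<ge> D v g - (3 * \<delta> + 1)" using vg by simp
    then have 1: "expo * gmin v x y z \<ge> expo * (D v g - (3 * \<delta> + 1))"
      by (intro mult_left_mono) auto
    have 2: "gmax v x y z \<ge> gp x y z - j - 1"
      using shift j gp_nonneg[of v z x] V by (simp add: gmax_def)
    have "tripod v x y z \<le> exp (- eps * (expo * (D v g - (3 * \<delta> + 1)) + (gp x y z - j - 1)))"
      unfolding tripod_def using add_mono[OF 1 2] eps_pos by simp
    also have "\<dots> = tripod_const * (exp (- eps * expo) ^ D v g * exp (- eps * (gp x y z - j)))"
      by (simp add: tripod_const_def exp_of_nat_mult[symmetric] mult_exp_exp algebra_simps)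
    also have "\<dots> \<le> tripod_const * (lam ^ D v g * exp (- eps * (gp x y z - j)))"
      using exp_expo by (intro mult_left_mono mult_right_mono power_mono) (auto simp: tripod_const_def)
    finally show "tripod v x y z \<le> tripod_const * (lam ^ D g v * exp (- eps * (gp x y z - j)))"
      using dist_sym[of v g] V g by simp
  qed
qed

section \<open>Summation over the legs of the tripod\<close>

definition leg_const :: real where
  "leg_const = 2 * tripod_const / (1 - exp (- eps))"

text \<open>Every vertex is charged to a point \<open>g j\<close> of a geodesic from
  \<open>x\<close> to \<open>y\<close>. Bounding its term by the sum over all \<open>j\<close> lets
  the sums be exchanged: the vertices around one \<open>g j\<close> cost at most 2 by
  \<open>sum_lam_le\<close>, and the factors in \<open>j\<close> form a geometric series decaying
  from the centre towards \<open>x\<close>.\<close>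

lemma sum_tripod_leg:
  assumes V: "x \<in> V" "y \<in> V" "z \<in> V" and A: "finite A" "A \<subseteq> V"
    and max: "\<And>v. v \<in> A \<Longrightarrow> gp v x y \<le> gp v y z \<and> gp v z x \<le> gp v y z"
  shows "(\<Sum>v\<in>A. tripod v x y z) \<le> leg_const"
proof -
  define P where "P = gp x y z"
  define J where "J = nat \<lfloor>P\<rfloor>"
  have P0: "P \<ge> 0" using gp_nonneg V by (simp add: P_def)
  then have J: "real J \<le> P" by (simp add: J_def)
  have "P \<le> D x y" using gp_le_dist[of x y z] V dist_sym[of x y] by (simp add: P_def)
  then have JD: "J \<le> D x y" using J by linarith
  have "\<exists>g. g \<in> V \<and> D x g = j \<and> D g y = D x y - j" if "j \<le> J" for j
    using ex_dist_split[of x y j] V JD that by (metis order_trans)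
  then obtain g where g: "\<And>j. j \<le> J \<Longrightarrow> g j \<in> V \<and> D x (g j) = j \<and> D (g j) y = D x y - j"
    by metis
  define h where "h v j = tripod_const * (lam ^ D (g j) v * exp (- eps * (P - real j)))" for v j
  have h0: "h v j \<ge> 0" for v j using lam_pos by (simp add: h_def tripod_const_def)
  have "(\<Sum>v\<in>A. tripod v x y z) \<le> (\<Sum>v\<in>A. \<Sum>j\<le>J. h v j)"
  proof (rule sum_mono)
    fix v assume v: "v \<in> A"
    obtain j where j: "real j \<le> gp x y z" "\<And>g. \<lbrakk>g \<in> V; D x g = j; D g y = D x y - j\<rbrakk> \<Longrightarrow>
       tripod v x y z \<le> tripod_const * (lam ^ D g v * exp (- eps * (gp x y z - j)))"
      using tripod_le_projection[of v x y z] V A max v by blast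
    have "j \<le> J" using j(1) P0 unfolding J_def P_def[symmetric] by linarith
    then have "tripod v x y z \<le> h v j" using j(2)[of "g j"] g by (simp add: h_def P_def)
    also have "\<dots> \<le> (\<Sum>j\<le>J. h v j)" using \<open>j \<le> J\<close> h0 by (intro member_le_sum) auto
    finally show "tripod v x y z \<le> (\<Sum>j\<le>J. h v j)" .
  qed
  also have "\<dots> = (\<Sum>j\<le>J. tripod_const * ((\<Sum>v\<in>A. lam ^ D (g j) v) * exp (- eps * (P - real j))))"
    by (subst sum.swap) (simp add: h_def sum_distrib_left sum_distrib_right)
  also have "\<dots> \<le> (\<Sum>j\<le>J. tripod_const * (2 * exp (- eps) ^ (J - j)))"
  proof (intro sum_mono mult_left_mono mult_mono)
    fix j assume "j \<in> {..J}"
    then have j: "j \<le> J" by simp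
    show "(\<Sum>v\<in>A. lam ^ D (g j) v) \<le> 2" using sum_lam_le A g j by blast
    have "exp (- eps * (P - real j)) \<le> exp (- eps * (real J - real j))" using J eps_pos by simp
    also have "\<dots> = exp (- eps) ^ (J - j)"
      using j by (simp add: exp_of_nat_mult[symmetric] of_nat_diff algebra_simps)
    finally show "exp (- eps * (P - real j)) \<le> exp (- eps) ^ (J - j)" .
  qed (use lam_pos in \<open>auto simp: tripod_const_def sum_nonneg\<close>)
  \<comment> \<open>The successors bring the exponents into the shape of
    \<open>sum.nat_diff_reindex\<close>, which reverses the order of summation.\<close>
  also have "\<dots> = 2 * tripod_const * (\<Sum>j<Suc J. exp (- eps) ^ (Suc J - Suc j))"
    by (simp add: sum_distrib_left lessThan_Suc_atMost mult_ac)
  also have "\<dots> \<le> 2 * tripod_const * (1 / (1 - exp (- eps)))"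
  proof (rule mult_left_mono)
    have "(\<Sum>j<Suc J. exp (- eps) ^ (Suc J - Suc j)) = (\<Sum>j<Suc J. exp (- eps) ^ j)"
      by (rule sum.nat_diff_reindex)
    also have "\<dots> \<le> (\<Sum>j. exp (- eps) ^ j)"
      using eps_pos by (intro sum_le_suminf) (auto intro: summable_geometric)
    also have "\<dots> = 1 / (1 - exp (- eps))"
      using eps_pos by (simp add: suminf_geometric)
    finally show "(\<Sum>j<Suc J. exp (- eps) ^ (Suc J - Suc j)) \<le> 1 / (1 - exp (- eps))" .
  qed (simp add: tripod_const_def)
  finally show ?thesis by (simp add: leg_const_def)
qed

lemma sum_tripod:
  assumes V: "x \<in> V" "y \<in> V" "z \<in> V" and A: "finite A" "A \<subseteq> V"
  shows "(\<Sum>v\<in>A. tripod v x y z) \<le> 3 * leg_const"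
proof -
  define leg where "leg x y z = {v \<in> A. gp v x y \<le> gp v y z \<and> gp v z x \<le> gp v y z}" for x y z
  have leg: "(\<Sum>v\<in>leg a b c. tripod v a b c) \<le> leg_const" if "a \<in> V" "b \<in> V" "c \<in> V" for a b c
    by (rule sum_tripod_leg[OF that]) (use A in \<open>auto simp: leg_def\<close>)
  have fin: "finite (leg a b c)" for a b c using A by (simp add: leg_def)
  have cover: "A = leg x y z \<union> (leg y z x \<union> leg z x y)" by (auto simp: leg_def)
  \<comment> \<open>The legs overlap where the largest product is attained twice, so the sums are
    only subadditive.\<close>
  have sum_Un: "(\<Sum>v\<in>B \<union> C. tripod v x y z) \<le> (\<Sum>v\<in>B. tripod v x y z) + (\<Sum>v\<in>C. tripod v x y z)"
    if "finite B" "finite C" for B C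
    using that sum.union_inter[of B C "\<lambda>v. tripod v x y z"]
      sum_nonneg[of "B \<inter> C" "\<lambda>v. tripod v x y z"] by (simp add: tripod_def)
  have rotate: "tripod v x y z = tripod v y z x" "tripod v x y z = tripod v z x y" for v
    using tripod_rotate[of v x y z] tripod_rotate[of v z x y] by simp_all
  have "(\<Sum>v\<in>leg x y z. tripod v x y z) \<le> leg_const" using leg V by blast
  moreover have "(\<Sum>v\<in>leg y z x. tripod v x y z) \<le> leg_const"
    unfolding rotate(1) using leg V by blast
  moreover have "(\<Sum>v\<in>leg z x y. tripod v x y z) \<le> leg_const"
    unfolding rotate(2) using leg V by blast
  moreover have "(\<Sum>v\<in>A. tripod v x y z) =
      (\<Sum>v\<in>leg x y z \<union> (leg y z x \<union> leg z x y). tripod v x y z)"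
    using cover by (rule arg_cong)
  ultimately show ?thesis
    using sum_Un[of "leg x y z" "leg y z x \<union> leg z x y"] sum_Un[of "leg y z x" "leg z x y"] fin
    by simp
qed

definition total_const :: real where
  "total_const = 2 * (real (expo + 1) * (3 * leg_const))"

text \<open>Replacing \<open>A\<close> by the product of its projections decouples the sums: the one
  over \<open>w\<close> is at most 2, the one over \<open>v\<close> is the tripod sum. The bound
  depends neither on \<open>A\<close> nor on the three vertices, so it survives the passage to ideal
  points.\<close>

lemma sum_cyc_vis_dist:
  assumes V: "x \<in> V" "y \<in> V" "z \<in> V" and A: "finite A" "A \<subseteq> V \<times> V"
  shows "(\<Sum>(v, w)\<in>A. lam ^ D v w * \<bar>cyc expo (vis_dist v) x y z w\<bar>) \<le> total_const"
proof -
  let ?B = "fst ` A" and ?C = "snd ` A"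
  have BC: "finite ?B" "finite ?C" "?B \<subseteq> V" "?C \<subseteq> V" using A by auto
  have "(\<Sum>(v, w)\<in>A. lam ^ D v w * \<bar>cyc expo (vis_dist v) x y z w\<bar>)
      \<le> (\<Sum>(v, w)\<in>?B \<times> ?C. lam ^ D v w * \<bar>cyc expo (vis_dist v) x y z w\<bar>)"
    using BC lam_pos by (intro sum_mono2) force+
  also have "\<dots> = (\<Sum>v\<in>?B. \<Sum>w\<in>?C. lam ^ D v w * \<bar>cyc expo (vis_dist v) x y z w\<bar>)"
    by (simp add: sum.cartesian_product)
  also have "\<dots> \<le> (\<Sum>v\<in>?B. \<Sum>w\<in>?C. lam ^ D v w * (real (expo + 1) * tripod v x y z))"
    using BC V lam_pos by (intro sum_mono mult_left_mono cyc_vis_dist_le) auto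
  also have "\<dots> = (\<Sum>v\<in>?B. (\<Sum>w\<in>?C. lam ^ D v w) * (real (expo + 1) * tripod v x y z))"
    by (simp add: sum_distrib_right)
  also have "\<dots> \<le> (\<Sum>v\<in>?B. 2 * (real (expo + 1) * tripod v x y z))"
    using BC by (intro sum_mono mult_right_mono sum_lam_le) (auto simp: tripod_def)
  also have "\<dots> = 2 * (real (expo + 1) * (\<Sum>v\<in>?B. tripod v x y z))"
    by (simp add: sum_distrib_left)
  also have "\<dots> \<le> total_const"
    unfolding total_const_def using sum_tripod[OF V BC(1,3)] by (intro mult_left_mono) auto
  finally show ?thesis .
qed

end

section \<open>Weak-* continuity of bounded families\<close>

lemma infsum_le_bound:
  fixes f :: "'a \<Rightarrow> real"
  assumes "\<And>a. a \<in> A \<Longrightarrow> 0 \<le> f a" "\<And>B. finite B \<Longrightarrow> B \<subseteq> A \<Longrightarrow> sum f B \<le> C"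
  shows "f summable_on A" "infsum f A \<le> C"
proof -
  show "f summable_on A"
    using assms by (intro nonneg_bounded_partial_sums_imp_summable_on[where C = C])
      (auto intro!: eventually_finite_subsets_at_top_weakI)
  then show "infsum f A \<le> C" using assms(2) by (rule infsum_le_finite_sums)
qed

text \<open>Outside a finite set an element \<open>g\<close> of \<open>c0_space A\<close> is small,
  so the common bound \<open>C\<close> makes the finite partial sums of the pairing with
  \<open>g\<close> converge uniformly in \<open>t\<close>. A uniform limit of continuous functions
  is continuous.\<close>

lemma continuous_map_weak_star:
  assumes bound: "\<And>t B. t \<in> topspace X \<Longrightarrow> finite B \<Longrightarrow> B \<subseteq> A \<Longrightarrow> (\<Sum>a\<in>B. \<bar>F t a\<bar>) \<le> C"
    and vanish: "\<And>t a. t \<in> topspace X \<Longrightarrow> a \<notin> A \<Longrightarrow> F t a = 0"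
    and cont: "\<And>a. a \<in> A \<Longrightarrow> continuous_map X euclideanreal (\<lambda>t. F t a)"
  shows "continuous_map X (weak_star_topology A) F"
proof -
  have sumF: "(\<lambda>a. \<bar>F t a\<bar>) summable_on A" "infsum (\<lambda>a. \<bar>F t a\<bar>) A \<le> C" if "t \<in> topspace X" for t
    using infsum_le_bound[of A "\<lambda>a. \<bar>F t a\<bar>" C] bound that by auto
  have F_l1: "F t \<in> l1_space A" if "t \<in> topspace X" for t
    using sumF vanish that by (simp add: l1_space_def)
  have pair: "continuous_map X euclideanreal (\<lambda>t. \<Sum>\<^sub>\<infinity>a\<in>A. F t a * g a)" if g: "g \<in> c0_space A" for g
  proof -
    have "continuous_map X Met_TC.mtopology (\<lambda>t. \<Sum>\<^sub>\<infinity>a\<in>A. F t a * g a)"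
    proof (rule Met_TC.continuous_map_uniform_limit[where F = "finite_subsets_at_top A"])
      show "\<forall>\<^sub>F B in finite_subsets_at_top A. continuous_map X Met_TC.mtopology (\<lambda>t. \<Sum>a\<in>B. F t a * g a)"
        using cont by (intro eventually_finite_subsets_at_top_weakI)
          (auto intro!: continuous_map_sum continuous_map_real_mult)
      fix e :: real assume e: "e > 0"
      \<comment> \<open>Gives \<open>e' * \<bar>C\<bar> < e\<close>; the absolute value and the
        summand 1 keep the denominator positive for every \<open>C\<close>.\<close>
      define e' where "e' = e / (2 * (\<bar>C\<bar> + 1))"
      have e': "e' > 0" "e' * \<bar>C\<bar> < e" using e by (auto simp: e'_def field_simps add_nonneg_pos)
      define B0 where "B0 = {a \<in> A. e' \<le> \<bar>g a\<bar>}"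
      have B0: "finite B0" "B0 \<subseteq> A" using g e' by (auto simp: c0_space_def B0_def)
      have "dist (\<Sum>a\<in>B. F t a * g a) (\<Sum>\<^sub>\<infinity>a\<in>A. F t a * g a) < e"
        if B: "finite B" "B0 \<subseteq> B" "B \<subseteq> A" and t: "t \<in> topspace X" for B t
      proof -
        let ?R = "A - B"
        have small: "\<bar>F t a * g a\<bar> \<le> e' * \<bar>F t a\<bar>" if "a \<in> ?R" for a
        proof -
          have "a \<in> A" "a \<notin> B0" using that B by auto
          then have "\<bar>g a\<bar> \<le> e'" by (simp add: B0_def)
          then show ?thesis
            using mult_right_mono[of "\<bar>g a\<bar>" e' "\<bar>F t a\<bar>"] by (simp add: abs_mult mult.commute)
        qed
        have sumR: "(\<lambda>a. \<bar>F t a\<bar>) summable_on ?R"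
          using sumF(1)[OF t] by (rule summable_on_subset_banach) auto
        then have sumR': "(\<lambda>a. e' * \<bar>F t a\<bar>) summable_on ?R" by (rule summable_on_cmult_right)
        have absR: "(\<lambda>a. \<bar>F t a * g a\<bar>) summable_on ?R"
          by (rule summable_on_comparison_test[OF sumR' small]) simp_all
        then have sumR'': "(\<lambda>a. F t a * g a) summable_on ?R"
          using abs_summable_summable[of "\<lambda>a. F t a * g a" ?R] by (simp only: real_norm_def)
        have split: "(\<Sum>\<^sub>\<infinity>a\<in>A. F t a * g a) = (\<Sum>a\<in>B. F t a * g a) + (\<Sum>\<^sub>\<infinity>a\<in>?R. F t a * g a)"
        proof -
          have "(\<Sum>\<^sub>\<infinity>a\<in>B \<union> ?R. F t a * g a) = infsum (\<lambda>a. F t a * g a) B + (\<Sum>\<^sub>\<infinity>a\<in>?R. F t a * g a)"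
            using B sumR'' by (intro infsum_Un_disjoint) auto
          then show ?thesis using B by (simp add: Un_absorb1)
        qed
        have "\<bar>\<Sum>\<^sub>\<infinity>a\<in>?R. F t a * g a\<bar> \<le> (\<Sum>\<^sub>\<infinity>a\<in>?R. \<bar>F t a * g a\<bar>)"
          using norm_infsum_bound[of "\<lambda>a. F t a * g a" ?R] absR by simp
        also have "\<dots> \<le> (\<Sum>\<^sub>\<infinity>a\<in>?R. e' * \<bar>F t a\<bar>)" by (rule infsum_mono[OF absR sumR' small])
        also have "\<dots> = e' * (\<Sum>\<^sub>\<infinity>a\<in>?R. \<bar>F t a\<bar>)" by (rule infsum_cmult_right')
        also have "\<dots> \<le> e' * \<bar>C\<bar>"
        proof (rule mult_left_mono)
          have "(\<Sum>\<^sub>\<infinity>a\<in>?R. \<bar>F t a\<bar>) \<le> C"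
            by (rule infsum_le_bound) (use bound t in auto)
          then show "(\<Sum>\<^sub>\<infinity>a\<in>?R. \<bar>F t a\<bar>) \<le> \<bar>C\<bar>" by linarith
        qed (use e' in simp)
        also have "\<dots> < e" by (rule e')
        finally show ?thesis unfolding split by (simp add: dist_real_def)
      qed
      then show "\<forall>\<^sub>F B in finite_subsets_at_top A. \<forall>t\<in>topspace X. (\<Sum>\<^sub>\<infinity>a\<in>A. F t a * g a) \<in> UNIV \<and>
          dist (\<Sum>a\<in>B. F t a * g a) (\<Sum>\<^sub>\<infinity>a\<in>A. F t a * g a) < e"
        unfolding eventually_finite_subsets_at_top using B0 by blast
    qed auto
    then show ?thesis by simp
  qed
  show ?thesis
    unfolding weak_star_topology_def
  proof (rule continuous_map_pullback')
    show "topspace X \<subseteq> F -` l1_space A" using F_l1 by auto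
    show "continuous_map X (product_topology (\<lambda>_. euclideanreal) (c0_space A))
        ((\<lambda>f. \<lambda>g\<in>c0_space A. \<Sum>\<^sub>\<infinity>a\<in>A. f a * g a) \<circ> F)"
      using pair by (auto simp: continuous_map_componentwise)
  qed
qed

section \<open>The visual metrics on the boundary\<close>

context hyperbolic_serre_graph
begin

section \<open>Limits of the pseudometrics along Cauchy sequences\<close>

definition vis_cauchy :: "'v \<Rightarrow> (nat \<Rightarrow> 'v) \<Rightarrow> bool" where
  "vis_cauchy b x \<longleftrightarrow> range x \<subseteq> V \<and>
     (\<forall>e>0. \<exists>M. \<forall>i\<ge>M. \<forall>j\<ge>M. vis_dist b (x i) (x j) < e)"

text \<open>Defined on sequences, so that constant sequences stand for vertices, Gromov sequences
  for ideal points, and \<open>cyc\<close> can mix both.\<close>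

definition vis_lim :: "'v \<Rightarrow> (nat \<Rightarrow> 'v) \<Rightarrow> (nat \<Rightarrow> 'v) \<Rightarrow> real" where
  "vis_lim b x y = lim (\<lambda>i. vis_dist b (x i) (y i))"

lemma vis_cauchy_in: "vis_cauchy b x \<Longrightarrow> x i \<in> V"
  by (auto simp: vis_cauchy_def)

lemma vis_cauchyD:
  "vis_cauchy b x \<Longrightarrow> e > 0 \<Longrightarrow> \<exists>M. \<forall>i\<ge>M. \<forall>j\<ge>M. vis_dist b (x i) (x j) < e"
  unfolding vis_cauchy_def by blast

lemma vis_cauchy_const: "w \<in> V \<Longrightarrow> vis_cauchy b (\<lambda>_. w)"
  by (auto simp: vis_cauchy_def vis_dist_refl)

lemma vis_dist_quad:
  assumes "x \<in> V" "y \<in> V" "x' \<in> V" "y' \<in> V"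
  shows "\<bar>vis_dist b x y - vis_dist b x' y'\<bar> \<le> vis_dist b x x' + vis_dist b y y'"
  using vis_dist_lipschitz[OF assms(1,3,2), of b] vis_dist_lipschitz[OF assms(2,4,3), of b]
    vis_dist_sym[OF assms(3,2), of b] vis_dist_sym[OF assms(3,4), of b] by linarith

text \<open>Two independent indices are kept because being asymptotic is a condition on the double
  sequence of products.\<close>

lemma vis_lim_joint:
  assumes x: "vis_cauchy b x" and y: "vis_cauchy b y" and e: "e > 0"
  shows "\<exists>M. \<forall>i\<ge>M. \<forall>j\<ge>M. \<bar>vis_dist b (x i) (y j) - vis_lim b x y\<bar> < e"
proof -
  have joint: "\<exists>M. \<forall>i\<ge>M. \<forall>j\<ge>M. \<forall>k\<ge>M. \<bar>vis_dist b (x i) (y j) - vis_dist b (x k) (y k)\<bar> < e"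
    if "e > 0" for e
  proof -
    have e2: "e / 2 > 0" using that by simp
    obtain M where M: "\<forall>i\<ge>M. \<forall>j\<ge>M. vis_dist b (x i) (x j) < e / 2"
      using vis_cauchyD[OF x e2] by blast
    obtain M' where M': "\<forall>i\<ge>M'. \<forall>j\<ge>M'. vis_dist b (y i) (y j) < e / 2"
      using vis_cauchyD[OF y e2] by blast
    have "\<bar>vis_dist b (x i) (y j) - vis_dist b (x k) (y k)\<bar> < e"
      if "i \<ge> max M M'" "j \<ge> max M M'" "k \<ge> max M M'" for i j k
    proof -
      have "vis_dist b (x i) (x k) < e / 2" "vis_dist b (y j) (y k) < e / 2" using M M' that by auto
      moreover have "\<bar>vis_dist b (x i) (y j) - vis_dist b (x k) (y k)\<bar>
          \<le> vis_dist b (x i) (x k) + vis_dist b (y j) (y k)"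
        by (rule vis_dist_quad) (use vis_cauchy_in x y in auto)
      ultimately show ?thesis by linarith
    qed
    then show ?thesis by blast
  qed
  have "Cauchy (\<lambda>i. vis_dist b (x i) (y i))"
    unfolding Cauchy_def dist_real_def using joint by blast
  then have lim: "(\<lambda>i. vis_dist b (x i) (y i)) \<longlonglongrightarrow> vis_lim b x y"
    unfolding vis_lim_def by (simp add: Cauchy_convergent_iff convergent_LIMSEQ_iff)
  have "e / 2 > 0" using e by simp
  then obtain M where M: "\<forall>i\<ge>M. \<forall>j\<ge>M. \<forall>k\<ge>M. \<bar>vis_dist b (x i) (y j) - vis_dist b (x k) (y k)\<bar> < e / 2"
    using joint by blast
  have "\<bar>vis_dist b (x i) (y j) - vis_lim b x y\<bar> \<le> e / 2" if "i \<ge> M" "j \<ge> M" for i j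
  proof (rule LIMSEQ_le_const2)
    show "(\<lambda>k. \<bar>vis_dist b (x i) (y j) - vis_dist b (x k) (y k)\<bar>)
        \<longlonglongrightarrow> \<bar>vis_dist b (x i) (y j) - vis_lim b x y\<bar>"
      by (intro tendsto_intros lim)
    show "\<exists>K. \<forall>k\<ge>K. \<bar>vis_dist b (x i) (y j) - vis_dist b (x k) (y k)\<bar> \<le> e / 2"
      using M that by (meson less_imp_le)
  qed
  then show ?thesis using e by (intro exI[of _ M]) fastforce
qed

lemma vis_lim_tendsto:
  assumes "vis_cauchy b x" "vis_cauchy b y"
  shows "(\<lambda>i. vis_dist b (x i) (y i)) \<longlonglongrightarrow> vis_lim b x y"
  unfolding LIMSEQ_def dist_real_def using vis_lim_joint[OF assms] by blast

lemma vis_lim_nonneg: "vis_cauchy b x \<Longrightarrow> vis_cauchy b y \<Longrightarrow> 0 \<le> vis_lim b x y"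
  by (rule LIMSEQ_le_const[OF vis_lim_tendsto]) (auto intro: vis_dist_nonneg vis_cauchy_in)

lemma vis_lim_sym: "vis_cauchy b x \<Longrightarrow> vis_cauchy b y \<Longrightarrow> vis_lim b x y = vis_lim b y x"
  unfolding vis_lim_def
  by (intro arg_cong[where f = lim] ext vis_dist_sym) (auto intro: vis_cauchy_in)

lemma vis_lim_triangle:
  assumes "vis_cauchy b x" "vis_cauchy b y" "vis_cauchy b z"
  shows "vis_lim b x z \<le> vis_lim b x y + vis_lim b y z"
  by (rule LIMSEQ_le[OF vis_lim_tendsto tendsto_add[OF vis_lim_tendsto vis_lim_tendsto]])
     (use assms in \<open>auto intro: vis_dist_triangle vis_cauchy_in\<close>)

lemma vis_lim_lipschitz:
  assumes "vis_cauchy b x" "vis_cauchy b y" "vis_cauchy b z"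
  shows "\<bar>vis_lim b x z - vis_lim b y z\<bar> \<le> vis_lim b x y"
  using vis_lim_triangle[OF assms] vis_lim_triangle[OF assms(2,1,3)] vis_lim_sym[OF assms(1,2)]
  by linarith

lemma vis_lim_self_tendsto:
  assumes x: "vis_cauchy b x" shows "(\<lambda>i. vis_lim b x (\<lambda>_. x i)) \<longlonglongrightarrow> 0"
  unfolding LIMSEQ_def
proof (intro allI impI)
  fix e :: real assume "e > 0"
  then have "e / 2 > 0" by simp
  then obtain M where M: "\<forall>i\<ge>M. \<forall>j\<ge>M. vis_dist b (x i) (x j) < e / 2"
    using vis_cauchyD[OF x] by blast
  have "dist (vis_lim b x (\<lambda>_. x i)) 0 < e" if "i \<ge> M" for i
  proof -
    note c = vis_cauchy_const[OF vis_cauchy_in[OF x], of b i]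
    have "vis_lim b x (\<lambda>_. x i) \<le> e / 2"
      by (rule LIMSEQ_le_const2[OF vis_lim_tendsto[OF x c]]) (use M that in \<open>meson less_imp_le\<close>)
    then show ?thesis using vis_lim_nonneg[OF x c] \<open>e > 0\<close> by simp
  qed
  then show "\<exists>M. \<forall>i\<ge>M. dist (vis_lim b x (\<lambda>_. x i)) 0 < e" by blast
qed

text \<open>Lets the vertex parameter \<open>w\<close> tend to an ideal point in the proof of
  non-vanishing.\<close>

lemma vis_lim_tail_tendsto:
  assumes x: "vis_cauchy b x" and y: "vis_cauchy b y"
  shows "(\<lambda>i. vis_lim b y (\<lambda>_. x i)) \<longlonglongrightarrow> vis_lim b y x"
proof (rule LIMSEQ_I)
  fix e :: real assume "e > 0"
  then obtain M where M: "\<forall>i\<ge>M. \<bar>vis_lim b x (\<lambda>_. x i)\<bar> < e"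
    using LIMSEQ_D[OF vis_lim_self_tendsto[OF x]] by fastforce
  have "norm (vis_lim b y (\<lambda>_. x i) - vis_lim b y x) < e" if "i \<ge> M" for i
  proof -
    note c = vis_cauchy_const[OF vis_cauchy_in[OF x], of b i]
    have "\<bar>vis_lim b x (\<lambda>_. x i)\<bar> < e" using M that by blast
    then show ?thesis
      using vis_lim_lipschitz[OF c x y] vis_lim_sym[OF c x] vis_lim_sym[OF c y] vis_lim_sym[OF x y]
      by (simp only: real_norm_def)
  qed
  then show "\<exists>M. \<forall>i\<ge>M. norm (vis_lim b y (\<lambda>_. x i) - vis_lim b y x) < e" by blast
qed

section \<open>Gromov sequences in terms of the pseudometrics\<close>

lemma gromov_asymptotic_weight:
  assumes "gromov_asymptotic G x y" "b \<in> V" "e > 0"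
  shows "\<exists>M. \<forall>i\<ge>M. \<forall>j\<ge>M. vis_weight b (x i) (y j) < e"
proof -
  \<comment> \<open>The summand 1 turns the weak bound on the product into a strict one on the
    weight.\<close>
  define Z where "Z = (1 - ln e) / eps"
  have "\<forall>\<^sub>F (i, j) in sequentially \<times>\<^sub>F sequentially. Z \<le> gp b (x i) (y j)"
    using assms(1,2) unfolding gromov_asymptotic_def filterlim_at_top by (auto simp: case_prod_unfold)
  then obtain M where M: "\<forall>i\<ge>M. \<forall>j\<ge>M. Z \<le> gp b (x i) (y j)"
    unfolding eventually_prod_sequentially by auto
  have "vis_weight b (x i) (y j) < e" if "i \<ge> M" "j \<ge> M" for i j
  proof -
    have "eps * Z \<le> eps * gp b (x i) (y j)" using M that eps_pos by (intro mult_left_mono) auto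
    then have "- eps * gp b (x i) (y j) < ln e" using eps_pos by (simp add: Z_def)
    then show ?thesis using assms(3) by (simp add: vis_weight_def ln_ge_iff exp_less_mono
          flip: exp_less_cancel_iff[of _ "ln e"])
  qed
  then show ?thesis by blast
qed

lemma gromov_sequences_in: "x \<in> gromov_sequences G \<Longrightarrow> x i \<in> V"
  by (auto simp: gromov_sequences_def)

lemma gromov_sequences_cauchy:
  assumes "x \<in> gromov_sequences G" "b \<in> V" shows "vis_cauchy b x"
  unfolding vis_cauchy_def
proof (intro conjI allI impI)
  show "range x \<subseteq> V" using assms by (simp add: gromov_sequences_def)
  fix e :: real assume "e > 0"
  then obtain M where "\<forall>i\<ge>M. \<forall>j\<ge>M. vis_weight b (x i) (x j) < e"
    using gromov_asymptotic_weight[of x x b e] assms by (auto simp: gromov_sequences_def)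
  then show "\<exists>M. \<forall>i\<ge>M. \<forall>j\<ge>M. vis_dist b (x i) (x j) < e"
    using vis_dist_le_weight gromov_sequences_in[OF assms(1)] by (meson order_le_less_trans)
qed

lemma asymptotic_imp_vis_lim:
  assumes "x \<in> gromov_sequences G" "y \<in> gromov_sequences G" "b \<in> V" "gromov_asymptotic G x y"
  shows "vis_lim b x y = 0"
proof (rule LIMSEQ_unique)
  show "(\<lambda>i. vis_dist b (x i) (y i)) \<longlonglongrightarrow> vis_lim b x y"
    using assms by (intro vis_lim_tendsto gromov_sequences_cauchy)
  show "(\<lambda>i. vis_dist b (x i) (y i)) \<longlonglongrightarrow> 0"
  proof (rule LIMSEQ_I)
    fix e :: real assume "e > 0"
    then obtain M where M: "\<forall>i\<ge>M. \<forall>j\<ge>M. vis_weight b (x i) (y j) < e"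
      using gromov_asymptotic_weight[OF assms(4,3)] by blast
    have "norm (vis_dist b (x i) (y i) - 0) < e" if "i \<ge> M" for i
      using M[rule_format, OF that that] vis_dist_le_weight[of "x i" "y i" b]
        vis_dist_nonneg[of "x i" "y i" b] gromov_sequences_in assms(1,2) by simp
    then show "\<exists>M. \<forall>i\<ge>M. norm (vis_dist b (x i) (y i) - 0) < e" by blast
  qed
qed

text \<open>Frink's lower bound converts small visual distance into small weight, that is, into a
  large Gromov product.\<close>

lemma vis_lim_imp_asymptotic:
  assumes x: "x \<in> gromov_sequences G" and y: "y \<in> gromov_sequences G" and b: "b \<in> V"
    and 0: "vis_lim b x y = 0"
  shows "gromov_asymptotic G x y"
  unfolding gromov_asymptotic_def filterlim_at_top
proof (intro ballI allI)
  fix c and Z :: real assume c: "c \<in> V"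
  \<comment> \<open>The margin \<open>D b c\<close> pays for the change of base point from
    \<open>b\<close> to an arbitrary \<open>c\<close>.\<close>
  define Z' where "Z' = Z + D b c"
  define e where "e = exp (- eps * Z')"
  have e: "e > 0" by (simp add: e_def)
  then obtain M where M: "\<forall>i\<ge>M. \<forall>j\<ge>M. vis_weight b (x i) (x j) < e"
    using gromov_asymptotic_weight[of x x b e] x b by (auto simp: gromov_sequences_def)
  have "e / 2 > 0" using e by simp
  then obtain M' where M': "\<forall>i\<ge>M'. \<forall>j\<ge>M'. \<bar>vis_dist b (x i) (y j)\<bar> < e / 2"
    using vis_lim_joint[of b x y "e / 2"] gromov_sequences_cauchy x y b 0 by auto
  have "Z \<le> gp c (x i) (y j)" if "i \<ge> max M M'" "j \<ge> max M M'" for i j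
  proof -
    have "vis_weight b (x i) (y j) < e"
    proof (cases "x i = y j")
      \<comment> \<open>Frink's bound excludes coinciding points. There the weight is that of
        \<open>x i\<close> with itself, which is small because \<open>x\<close> is a Gromov
        sequence.\<close>
      case True
      then show ?thesis using M that by (metis max.bounded_iff)
    next
      case False
      have "\<bar>vis_dist b (x i) (y j)\<bar> < e / 2" using M' that by simp
      moreover have "vis_weight b (x i) (y j) \<le> 2 * vis_dist b (x i) (y j)"
        by (rule weight_le_vis_dist[OF b _ _ False]) (use gromov_sequences_in x y in auto)
      ultimately show ?thesis by linarith
    qed
    then have "Z' < gp b (x i) (y j)" using eps_pos by (simp add: vis_weight_def e_def)
    then show ?thesis
      using gp_base_change[of b c "x i" "y j"] gromov_sequences_in x y b c by (simp add: Z'_def)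
  qed
  then show "\<forall>\<^sub>F p in sequentially \<times>\<^sub>F sequentially. Z \<le> (case p of (i, j) \<Rightarrow> gp c (x i) (y j))"
    unfolding eventually_prod_sequentially by (intro exI[of _ "max M M'"]) auto
qed

end

section \<open>Algebra of the coboundary\<close>

lemma cyc_swap:
  assumes "d x y = d y x" "d y z = d z y" "d z x = d x z"
  shows "cyc K d y x z w = - cyc K d x y z w"
  using assms by (simp add: cyc_def algebra_simps)

text \<open>The edges shared with the same orientation cancel outright; those between
  \<open>y\<close> and \<open>u\<close> and between \<open>x\<close> and \<open>z\<close> occur in
  both orientations and cancel by the symmetry assumptions.\<close>

lemma cyc_cocycle:
  assumes "d y u = d u y" "d z x = d x z"
  shows "cyc K d y z u w - cyc K d x z u w + cyc K d x y u w - cyc K d x y z w = 0"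
  using assms by (simp add: cyc_def algebra_simps)

text \<open>A 3-cycle and a transposition generate the symmetric group; its six elements are listed
  by \<open>permutes_insert\<close> and checked one by one.\<close>

lemma alternating_onI:
  assumes rot: "\<And>x y z p. x \<in> X \<Longrightarrow> y \<in> X \<Longrightarrow> z \<in> X \<Longrightarrow> \<omega> y z x p = \<omega> x y z p"
    and swap: "\<And>x y z p. x \<in> X \<Longrightarrow> y \<in> X \<Longrightarrow> z \<in> X \<Longrightarrow> \<omega> y x z p = - \<omega> x y z p"
  shows "alternating_on X \<omega>"
  unfolding alternating_on_def
proof (intro allI impI)
  fix \<sigma> :: "nat \<Rightarrow> nat" and x :: "nat \<Rightarrow> _" and p assume \<sigma>: "\<sigma> permutes {1,2,3}" and x: "x \<in> {1,2,3} \<rightarrow> X"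
  have X: "x 1 \<in> X" "x 2 \<in> X" "x 3 \<in> X" using x by auto
  have "\<sigma> \<in> {\<sigma>. \<sigma> permutes insert 1 (insert 2 (insert 3 {}))}" using \<sigma> by simp
  then have "\<sigma> \<in> {id, Transposition.transpose 2 3, Transposition.transpose 1 2, Transposition.transpose 1 3, Transposition.transpose 1 2 \<circ> Transposition.transpose 2 3, Transposition.transpose 1 3 \<circ> Transposition.transpose 2 3}"
    unfolding permutes_insert by auto
  moreover note rot[OF X, of p] rot[OF X(2,3,1), of p]
    swap[OF X, of p] swap[OF X(2,3,1), of p] swap[OF X(3,1,2), of p]
  ultimately show "\<omega> (x (\<sigma> 1)) (x (\<sigma> 2)) (x (\<sigma> 3)) p = of_int (sign \<sigma>) * \<omega> (x 1) (x 2) (x 3) p"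
    by (auto simp: sign_compose sign_swap_id permutation_swap_id Transposition.transpose_def)
qed

context hyperbolic_serre_graph
begin

section \<open>Boundary points as classes of sequences at distance 0\<close>

lemma vis_lim_cong:
  assumes "vis_cauchy b x" "vis_cauchy b x'" "vis_cauchy b y" "vis_lim b x x' = 0"
  shows "vis_lim b x y = vis_lim b x' y"
  using vis_lim_lipschitz[OF assms(1,2,3)] assms(4) by simp

lemma asymptotic_iff:
  assumes "x \<in> gromov_sequences G" "y \<in> gromov_sequences G" "b \<in> V"
  shows "gromov_asymptotic G x y \<longleftrightarrow> vis_lim b x y = 0"
  using asymptotic_imp_vis_lim[OF assms] vis_lim_imp_asymptotic[OF assms] by blast

abbreviation "bdry \<equiv> gromov_boundary G"

lemma boundary_elim:
  assumes "\<xi> \<in> bdry"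
  obtains x where "x \<in> gromov_sequences G" "\<xi> = {y \<in> gromov_sequences G. gromov_asymptotic G x y}"
  using assms by (auto simp: gromov_boundary_def quotient_def)

lemma boundary_sequence: "\<xi> \<in> bdry \<Longrightarrow> x \<in> \<xi> \<Longrightarrow> x \<in> gromov_sequences G"
  by (erule boundary_elim) simp

lemma boundary_cauchy: "\<xi> \<in> bdry \<Longrightarrow> x \<in> \<xi> \<Longrightarrow> b \<in> V \<Longrightarrow> vis_cauchy b x"
  using boundary_sequence gromov_sequences_cauchy by blast

lemma boundary_vis_lim_0:
  assumes "\<xi> \<in> bdry" "x \<in> \<xi>" "y \<in> \<xi>" "b \<in> V"
  shows "vis_lim b x y = 0"
proof -
  obtain x0 where x0: "x0 \<in> gromov_sequences G" "\<xi> = {y \<in> gromov_sequences G. gromov_asymptotic G x0 y}"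
    using assms(1) by (rule boundary_elim)
  have "vis_lim b x0 x = 0" "vis_lim b x0 y = 0"
    using x0 assms asymptotic_iff by auto
  moreover have "vis_cauchy b x0" "vis_cauchy b x" "vis_cauchy b y"
    using gromov_sequences_cauchy x0 assms by auto
  ultimately show ?thesis using vis_lim_cong[of b x0 x y] by simp
qed

text \<open>A boundary point consists of the Gromov sequences at distance 0 from a representative,
  and representatives at distance 0 from each other have the same distances to all
  sequences.\<close>

lemma boundary_eqI:
  assumes "\<xi> \<in> bdry" "\<eta> \<in> bdry" "x \<in> \<xi>" "y \<in> \<eta>" "b \<in> V" "vis_lim b x y = 0"
  shows "\<xi> = \<eta>"
proof -
  obtain x0 where x0: "x0 \<in> gromov_sequences G" "\<xi> = {y \<in> gromov_sequences G. gromov_asymptotic G x0 y}"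
    using assms(1) by (rule boundary_elim)
  obtain y0 where y0: "y0 \<in> gromov_sequences G" "\<eta> = {y \<in> gromov_sequences G. gromov_asymptotic G y0 y}"
    using assms(2) by (rule boundary_elim)
  have seq: "x \<in> gromov_sequences G" "y \<in> gromov_sequences G"
    using boundary_sequence assms by auto
  note c = gromov_sequences_cauchy[OF _ assms(5)]
  have "vis_lim b x0 x = 0" "vis_lim b y0 y = 0" using x0 y0 assms asymptotic_iff by auto
  then have "vis_lim b x0 z = vis_lim b y0 z" if "z \<in> gromov_sequences G" for z
    using vis_lim_cong[of b x0 x z] vis_lim_cong[of b x y z] vis_lim_cong[of b y0 y z]
      c x0(1) y0(1) seq that assms(6) by simp
  then show ?thesis unfolding x0(2) y0(2) using asymptotic_iff[OF _ _ assms(5)] x0(1) y0(1) by auto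
qed

definition rep :: "(nat \<Rightarrow> 'v) set \<Rightarrow> nat \<Rightarrow> 'v" where
  "rep \<xi> = (SOME x. x \<in> \<xi>)"

lemma rep_in:
  assumes "\<xi> \<in> bdry" shows "rep \<xi> \<in> \<xi>"
proof -
  obtain x where "x \<in> gromov_sequences G" "\<xi> = {y \<in> gromov_sequences G. gromov_asymptotic G x y}"
    using assms by (rule boundary_elim)
  then have "x \<in> \<xi>" by (simp add: gromov_sequences_def)
  then show ?thesis unfolding rep_def by (rule someI[where P = "\<lambda>x. x \<in> \<xi>"])
qed

lemma rep_cauchy: "\<xi> \<in> bdry \<Longrightarrow> b \<in> V \<Longrightarrow> vis_cauchy b (rep \<xi>)"
  using boundary_cauchy rep_in by blast

definition bdist :: "'v \<Rightarrow> (nat \<Rightarrow> 'v) set \<Rightarrow> (nat \<Rightarrow> 'v) set \<Rightarrow> real" where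
  "bdist b \<xi> \<eta> = vis_lim b (rep \<xi>) (rep \<eta>)"

lemma vis_lim_rep:
  assumes "\<xi> \<in> bdry" "x \<in> \<xi>" "b \<in> V" "vis_cauchy b y"
  shows "vis_lim b (rep \<xi>) y = vis_lim b x y" "vis_lim b y (rep \<xi>) = vis_lim b y x"
proof -
  show 1: "vis_lim b (rep \<xi>) y = vis_lim b x y"
    using assms rep_cauchy boundary_cauchy boundary_vis_lim_0 rep_in by (intro vis_lim_cong) blast+
  show "vis_lim b y (rep \<xi>) = vis_lim b y x"
    using 1 vis_lim_sym[OF rep_cauchy[OF assms(1,3)] assms(4)]
      vis_lim_sym[OF boundary_cauchy[OF assms(1,2,3)] assms(4)] by simp
qed

lemma bdist_eq:
  assumes "\<xi> \<in> bdry" "\<eta> \<in> bdry" "x \<in> \<xi>" "y \<in> \<eta>" "b \<in> V"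
  shows "bdist b \<xi> \<eta> = vis_lim b x y"
  unfolding bdist_def
  using vis_lim_rep(1)[OF assms(1,3,5) rep_cauchy[OF assms(2,5)]]
    vis_lim_rep(2)[OF assms(2,4,5) boundary_cauchy[OF assms(1,3,5)]] by simp

lemma bdist_refl: "\<xi> \<in> bdry \<Longrightarrow> b \<in> V \<Longrightarrow> bdist b \<xi> \<xi> = 0"
  unfolding bdist_def using boundary_vis_lim_0 rep_in by blast

lemma bdist_nonneg: "\<xi> \<in> bdry \<Longrightarrow> \<eta> \<in> bdry \<Longrightarrow> b \<in> V \<Longrightarrow> 0 \<le> bdist b \<xi> \<eta>"
  unfolding bdist_def using vis_lim_nonneg rep_cauchy by blast

lemma bdist_sym: "\<xi> \<in> bdry \<Longrightarrow> \<eta> \<in> bdry \<Longrightarrow> b \<in> V \<Longrightarrow> bdist b \<xi> \<eta> = bdist b \<eta> \<xi>"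
  unfolding bdist_def using vis_lim_sym rep_cauchy by blast

lemma bdist_lipschitz:
  assumes "\<xi> \<in> bdry" "\<eta> \<in> bdry" "\<zeta> \<in> bdry" "b \<in> V"
  shows "\<bar>bdist b \<xi> \<zeta> - bdist b \<eta> \<zeta>\<bar> \<le> bdist b \<xi> \<eta>"
  unfolding bdist_def using vis_lim_lipschitz rep_cauchy assms by blast

lemma bdist_pos:
  assumes "\<xi> \<in> bdry" "\<eta> \<in> bdry" "\<xi> \<noteq> \<eta>" "b \<in> V"
  shows "bdist b \<xi> \<eta> > 0"
proof -
  have "bdist b \<xi> \<eta> \<noteq> 0"
    using boundary_eqI[OF assms(1,2) rep_in[OF assms(1)] rep_in[OF assms(2)] assms(4)] assms(3)
    unfolding bdist_def by blast
  then show ?thesis using bdist_nonneg[OF assms(1,2,4)] by linarith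
qed

text \<open>A supremum of lower limits above \<open>r\<close> provides one pair of representatives
  whose products eventually exceed \<open>r\<close>, and \<open>bdist\<close> may be computed from
  any pair. The factor \<open>exp (eps * D b c)\<close> is the cost of moving the base
  point.\<close>

lemma bdist_le_boundary_product:
  assumes \<xi>: "\<xi> \<in> bdry" and \<eta>: "\<eta> \<in> bdry" and bc: "b \<in> V" "c \<in> V"
    and r: "ereal r < boundary_product G c \<xi> \<eta>"
  shows "bdist b \<xi> \<eta> \<le> exp (eps * D b c) * exp (- eps * r)"
proof -
  obtain x y where xy: "x \<in> \<xi>" "y \<in> \<eta>" and
    lim: "ereal r < Liminf (sequentially \<times>\<^sub>F sequentially) (\<lambda>(i, j). ereal (gp c (x i) (y j)))"
    using r unfolding boundary_product_def less_SUP_iff by auto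
  have "\<forall>\<^sub>F p in sequentially \<times>\<^sub>F sequentially. ereal r < (case p of (i, j) \<Rightarrow> ereal (gp c (x i) (y j)))"
    by (rule less_LiminfD[OF lim])
  then obtain M where M: "\<And>i j. i \<ge> M \<Longrightarrow> j \<ge> M \<Longrightarrow> r < gp c (x i) (y j)"
    unfolding eventually_prod_sequentially by auto
  have "vis_dist b (x i) (y i) \<le> exp (eps * D b c) * exp (- eps * r)" if "i \<ge> M" for i
  proof -
    have V: "x i \<in> V" "y i \<in> V"
      using gromov_sequences_in boundary_sequence \<xi> \<eta> xy by blast+
    have "vis_dist b (x i) (y i) \<le> exp (- eps * gp b (x i) (y i))"
      using vis_dist_le_weight[OF V, of b] by (simp add: vis_weight_def)
    also have "\<dots> \<le> exp (- eps * (r - D b c))"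
    proof -
      have "r - D b c \<le> gp b (x i) (y i)"
        using M[OF that that] gp_base_change[OF bc(2,1) V] dist_sym[OF bc] by simp
      then have "eps * (r - D b c) \<le> eps * gp b (x i) (y i)" using eps_pos by (intro mult_left_mono) auto
      then show ?thesis by simp
    qed
    also have "\<dots> = exp (eps * D b c) * exp (- eps * r)" by (simp add: mult_exp_exp algebra_simps)
    finally show ?thesis .
  qed
  then have "vis_lim b x y \<le> exp (eps * D b c) * exp (- eps * r)"
    by (intro LIMSEQ_le_const2[OF vis_lim_tendsto[OF boundary_cauchy[OF \<xi> xy(1) bc(1)]
          boundary_cauchy[OF \<eta> xy(2) bc(1)]]] exI[of _ M]) simp
  then show ?thesis using bdist_eq[OF \<xi> \<eta> xy bc(1)] by simp
qed

text \<open>Every ball for \<open>bdist\<close> contains a basic neighbourhood of its centre in the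
  boundary topology.\<close>

lemma lipschitz_continuous_map:
  fixes f :: "(nat \<Rightarrow> 'v) set \<Rightarrow> real"
  assumes b: "b \<in> V" and lip: "\<And>\<xi> \<eta>. \<xi> \<in> bdry \<Longrightarrow> \<eta> \<in> bdry \<Longrightarrow> \<bar>f \<xi> - f \<eta>\<bar> \<le> bdist b \<xi> \<eta>"
  shows "continuous_map (boundary_topology G) euclideanreal f"
  unfolding continuous_map_def topspace_boundary_topology
proof (intro conjI allI impI)
  show "f \<in> bdry \<rightarrow> topspace euclideanreal" by simp
  fix U :: "real set" assume "openin euclideanreal U"
  then have U: "open U" by simp
  show "openin (boundary_topology G) {\<xi> \<in> bdry. f \<xi> \<in> U}"
    unfolding openin_boundary_topology
  proof (intro conjI ballI)
    fix \<xi> c assume \<xi>: "\<xi> \<in> {\<xi> \<in> bdry. f \<xi> \<in> U}" and c: "c \<in> V"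
    then obtain e where e: "e > 0" "\<And>t. dist t (f \<xi>) < e \<Longrightarrow> t \<in> U"
      using U unfolding open_dist by blast
    \<comment> \<open>Chosen so that the bound on \<open>bdist\<close> becomes
      \<open>exp (ln e - 1)\<close>, strictly below \<open>e\<close>.\<close>
    define r where "r = D b c + (1 - ln e) / eps"
    have "exp (eps * D b c) * exp (- eps * r) = exp (ln e - 1)"
      unfolding mult_exp_exp using eps_pos by (simp add: r_def field_simps)
    also have "\<dots> < exp (ln e)" by (simp only: exp_less_cancel_iff)
    also have "\<dots> = e" using e by simp
    finally have small: "exp (eps * D b c) * exp (- eps * r) < e" .
    have "f \<eta> \<in> U" if \<eta>: "\<eta> \<in> bdry" "ereal r < boundary_product G c \<xi> \<eta>" for \<eta>
    proof -
      have "bdist b \<xi> \<eta> < e"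
        using bdist_le_boundary_product[of \<xi> \<eta> b c r] \<xi> \<eta> b c small by simp
      then show ?thesis using e(2) lip[of \<xi> \<eta>] \<xi> \<eta> by (simp add: dist_real_def)
    qed
    then show "\<exists>r. {\<eta> \<in> bdry. ereal r < boundary_product G c \<xi> \<eta>} \<subseteq> {\<xi> \<in> bdry. f \<xi> \<in> U}"
      by (intro exI[of _ r]) auto
  qed auto
qed

lemma continuous_map_bdist:
  assumes b: "b \<in> V" and p: "continuous_map X (boundary_topology G) p"
    and q: "continuous_map X (boundary_topology G) q"
  shows "continuous_map X euclideanreal (\<lambda>t. bdist b (p t) (q t))"
proof -
  have pq: "p t \<in> bdry" "q t \<in> bdry" if "t \<in> topspace X" for t
    using that p q by (auto simp: continuous_map_def topspace_boundary_topology)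
  have ball: "openin X {t \<in> topspace X. bdist b \<xi> (f t) < e}"
    if "\<xi> \<in> bdry" "continuous_map X (boundary_topology G) f" for \<xi> f e
  proof -
    have "continuous_map (boundary_topology G) euclideanreal (bdist b \<xi>)"
      using that b bdist_lipschitz bdist_sym by (intro lipschitz_continuous_map[OF b]) metis
    from continuous_map_compose[OF that(2) this]
    have "openin X {t \<in> topspace X. (bdist b \<xi> \<circ> f) t \<in> {..<e}}"
      by (rule openin_continuous_map_preimage) simp
    then show ?thesis by simp
  qed
  have "continuous_map X Met_TC.mtopology (\<lambda>t. bdist b (p t) (q t))"
    unfolding Met_TC.continuous_map_to_metric
  proof (intro ballI allI impI)
    fix t and e :: real assume t: "t \<in> topspace X" and e: "0 < e"
    let ?U = "{s \<in> topspace X. bdist b (p t) (p s) < e / 2} \<inter> {s \<in> topspace X. bdist b (q t) (q s) < e / 2}"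
    have "openin X ?U" by (intro openin_Int ball pq p q t)
    moreover have "t \<in> ?U" using t e pq b by (simp add: bdist_refl)
    moreover have "bdist b (p s) (q s) \<in> Met_TC.mball (bdist b (p t) (q t)) e" if s: "s \<in> ?U" for s
    proof -
      note P = pq[OF t] and Q = pq[of s]
      have "\<bar>bdist b (p t) (q t) - bdist b (p s) (q t)\<bar> \<le> bdist b (p t) (p s)"
        using s P Q b by (intro bdist_lipschitz) auto
      moreover have "\<bar>bdist b (q t) (p s) - bdist b (q s) (p s)\<bar> \<le> bdist b (q t) (q s)"
        using s P Q b by (intro bdist_lipschitz) auto
      moreover have "bdist b (q t) (p s) = bdist b (p s) (q t)" "bdist b (q s) (p s) = bdist b (p s) (q s)"
        using s P Q b by (auto intro: bdist_sym)
      ultimately have "\<bar>bdist b (p t) (q t) - bdist b (p s) (q s)\<bar> < e" using s by auto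
      then show ?thesis by (simp add: dist_real_def)
    qed
    ultimately show "\<exists>U. openin X U \<and> t \<in> U \<and>
        (\<forall>s\<in>U. bdist b (p s) (q s) \<in> Met_TC.mball (bdist b (p t) (q t)) e)"
      by blast
  qed
  then show ?thesis by simp
qed

section \<open>The cochain on pairs of vertices\<close>

definition cochain :: "'v \<Rightarrow> 'v \<Rightarrow> (nat \<Rightarrow> 'v) \<Rightarrow> (nat \<Rightarrow> 'v) \<Rightarrow> (nat \<Rightarrow> 'v) \<Rightarrow> real" where
  "cochain v w x y z = lam ^ D v w * cyc expo (vis_lim v) x y z (\<lambda>_. w)"

lemma cyc_tendsto:
  assumes "vis_cauchy b x" "vis_cauchy b y" "vis_cauchy b z" "w \<in> V"
  shows "(\<lambda>i. cyc expo (vis_dist b) (x i) (y i) (z i) w) \<longlonglongrightarrow> cyc expo (vis_lim b) x y z (\<lambda>_. w)"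
  unfolding cyc_def
  by (intro tendsto_intros vis_lim_tendsto assms
      vis_lim_tendsto[where y = "\<lambda>_. w", OF _ vis_cauchy_const[OF assms(4)]])

text \<open>The estimate for vertices is uniform, so it passes to the limit along the three
  sequences.\<close>

lemma sum_cochain:
  assumes c: "\<And>b. b \<in> V \<Longrightarrow> vis_cauchy b x" "\<And>b. b \<in> V \<Longrightarrow> vis_cauchy b y" "\<And>b. b \<in> V \<Longrightarrow> vis_cauchy b z"
    and A: "finite A" "A \<subseteq> V \<times> V"
  shows "(\<Sum>(v, w)\<in>A. \<bar>cochain v w x y z\<bar>) \<le> total_const"
proof (cases "A = {}")
  \<comment> \<open>The claim is \<open>0 \<le> total_const\<close>. Connectedness includes the
    existence of a vertex, at which the estimate over the empty set gives this.\<close>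
  case True
  then show ?thesis
    using sum_cyc_vis_dist[of _ _ _ "{}"] by (cases "V = {}")
      (use connected in \<open>auto simp: connected_conv\<close>)
next
  case False
  then obtain b where b: "b \<in> V" using A by auto
  have V: "x i \<in> V" "y i \<in> V" "z i \<in> V" for i
    using vis_cauchy_in[OF c(1)[OF b]] vis_cauchy_in[OF c(2)[OF b]] vis_cauchy_in[OF c(3)[OF b]] by auto
  show ?thesis
  proof (rule LIMSEQ_le_const2)
    show "(\<lambda>i. \<Sum>(v, w)\<in>A. lam ^ D v w * \<bar>cyc expo (vis_dist v) (x i) (y i) (z i) w\<bar>)
        \<longlonglongrightarrow> (\<Sum>(v, w)\<in>A. \<bar>cochain v w x y z\<bar>)"
    proof (rule tendsto_sum)
      fix p assume p: "p \<in> A"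
      obtain v w where vw: "p = (v, w)" "v \<in> V" "w \<in> V" using p A by auto
      have "(\<lambda>i. lam ^ D v w * \<bar>cyc expo (vis_dist v) (x i) (y i) (z i) w\<bar>)
          \<longlonglongrightarrow> lam ^ D v w * \<bar>cyc expo (vis_lim v) x y z (\<lambda>_. w)\<bar>"
        using vw c by (intro tendsto_intros cyc_tendsto)
      then show "(\<lambda>i. case p of (v, w) \<Rightarrow> lam ^ D v w * \<bar>cyc expo (vis_dist v) (x i) (y i) (z i) w\<bar>)
          \<longlonglongrightarrow> (case p of (v, w) \<Rightarrow> \<bar>cochain v w x y z\<bar>)"
        using lam_pos by (simp add: vw cochain_def abs_mult)
    qed
    show "\<exists>M. \<forall>i\<ge>M. (\<Sum>(v, w)\<in>A. lam ^ D v w * \<bar>cyc expo (vis_dist v) (x i) (y i) (z i) w\<bar>) \<le> total_const"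
      using sum_cyc_vis_dist[OF V A] by blast
  qed
qed

lemma cochain_cong:
  assumes "\<xi> \<in> bdry" "\<eta> \<in> bdry" "\<zeta> \<in> bdry" "x \<in> \<xi>" "y \<in> \<eta>" "z \<in> \<zeta>" "v \<in> V" "w \<in> V"
  shows "cochain v w x y z = cochain v w (rep \<xi>) (rep \<eta>) (rep \<zeta>)"
proof -
  note c = vis_cauchy_const[OF assms(8)]
  have "vis_lim v x y = bdist v \<xi> \<eta>" "vis_lim v y z = bdist v \<eta> \<zeta>" "vis_lim v z x = bdist v \<zeta> \<xi>"
    using bdist_eq assms by metis+
  moreover have "vis_lim v x (\<lambda>_. w) = vis_lim v (rep \<xi>) (\<lambda>_. w)"
    "vis_lim v y (\<lambda>_. w) = vis_lim v (rep \<eta>) (\<lambda>_. w)" "vis_lim v z (\<lambda>_. w) = vis_lim v (rep \<zeta>) (\<lambda>_. w)"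
    using vis_lim_rep(1) assms c by metis+
  ultimately show ?thesis by (simp add: cochain_def cyc_def bdist_def)
qed

text \<open>Weights, chain distances and their limits are built from the path metric alone, so its
  invariance propagates.\<close>

lemma cochain_automorphism:
  assumes auto: "graph_automorphism G arev \<phi> \<psi>"
    and V: "v \<in> V" "w \<in> V" "\<And>i. x i \<in> V" "\<And>i. y i \<in> V" "\<And>i. z i \<in> V"
  shows "cochain (\<phi> v) (\<phi> w) (\<phi> \<circ> x) (\<phi> \<circ> y) (\<phi> \<circ> z) = cochain v w x y z"
proof -
  have bij: "bij_betw \<phi> V V" using auto by (simp add: graph_automorphism_def)
  have weight: "vis_weight (\<phi> v) (\<phi> a) (\<phi> b) = vis_weight v a b" if "a \<in> V" "b \<in> V" for a b
    using dist_automorphism[OF auto] that V by (simp add: vis_weight_def gromov_product_def)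
  have "vis_dist (\<phi> v) (\<phi> a) (\<phi> b) = vis_dist v a b" if "a \<in> V" "b \<in> V" for a b
    unfolding vis_dist_def using bij weight that by (rule chain_dist_map)
  then have lim: "vis_lim (\<phi> v) (\<phi> \<circ> s) (\<phi> \<circ> t) = vis_lim v s t" if "\<And>i. s i \<in> V" "\<And>i. t i \<in> V" for s t
    using that by (simp add: vis_lim_def)
  have "(\<lambda>_. \<phi> w) = \<phi> \<circ> (\<lambda>_::nat. w)" by auto
  then show ?thesis
    using lim V dist_automorphism[OF auto V(1,2)] by (simp only: cochain_def cyc_def)
qed

section \<open>Non-vanishing on triples of distinct points\<close>

lemma expo_pos: "expo > 0"
proof -
  have "ln (2 * (real N + 1)) / eps > 0" using eps_pos by (intro divide_pos_pos ln_gt_zero) auto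
  then show ?thesis by (simp add: expo_def)
qed

text \<open>The three limits \<open>w \<rightarrow> \<xi>, \<eta>, \<zeta>\<close> give a linear system for the differences of
  \<open>p\<^sup>K, q\<^sup>K, r\<^sup>K\<close> whose matrix has determinant \<open>2pqr\<close>.\<close>

lemma distances_eq_if_cyc_vanishes:
  fixes p q r :: real
  assumes pos: "p > 0" "q > 0" "r > 0" and K: "K > 0"
    and eq: "(r ^ K - p ^ K) * p + (q ^ K - r ^ K) * q = 0"
      "(p ^ K - q ^ K) * p + (q ^ K - r ^ K) * r = 0"
      "(p ^ K - q ^ K) * q + (r ^ K - p ^ K) * r = 0"
  shows "p = r"
proof -
  define a b c where abc: "a = p ^ K - q ^ K" "b = r ^ K - p ^ K" "c = q ^ K - r ^ K"
  have e: "b * p + c * q = 0" "a * p + c * r = 0" "a * q + b * r = 0" using eq by (auto simp: abc)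
  \<comment> \<open>The multipliers \<open>r\<close>, \<open>- q\<close>, \<open>p\<close> eliminate
    \<open>a\<close> and \<open>c\<close>.\<close>
  have "2 * b * (p * r) = r * (b * p + c * q) - q * (a * p + c * r) + p * (a * q + b * r)"
    by (simp add: algebra_simps)
  then have "b * (p * r) = 0" unfolding e by simp
  then have "r ^ K = p ^ K" using pos by (simp add: abc)
  then show ?thesis using pos K by (simp add: power_eq_iff_eq_base)
qed

text \<open>Vanishing at all vertices \<open>w\<close> extends by continuity to limits of
  \<open>w\<close>; the limits \<open>x\<close>, \<open>y\<close> and \<open>z\<close> yield one
  equation of the linear system each.\<close>

lemma vis_lim_eq_if_cochain_vanishes:
  assumes v: "v \<in> V" and c: "vis_cauchy v x" "vis_cauchy v y" "vis_cauchy v z"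
    and pos: "vis_lim v x y > 0" "vis_lim v z x > 0" "vis_lim v y z > 0"
    and 0: "\<And>w. w \<in> V \<Longrightarrow> cochain v w x y z = 0"
  shows "vis_lim v x y = vis_lim v y z"
proof -
  let ?d = "vis_lim v"
  let ?p = "?d x y" and ?q = "?d z x" and ?r = "?d y z"
  have sym: "?d y x = ?p" "?d x z = ?q" "?d z y = ?r" using vis_lim_sym c by auto
  have self: "?d s s = 0" if "vis_cauchy v s" for s
    using that by (simp add: vis_lim_def vis_dist_refl vis_cauchy_in)
  have cyc0: "cyc expo ?d x y z (\<lambda>_. w) = 0" if "w \<in> V" for w
    using 0[OF that] lam_pos by (simp add: cochain_def)
  have lim: "cyc expo ?d x y z s = 0" if s: "vis_cauchy v s" for s
  proof (rule LIMSEQ_unique)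
    show "(\<lambda>i. cyc expo ?d x y z (\<lambda>_. s i)) \<longlonglongrightarrow> cyc expo ?d x y z s"
      unfolding cyc_def by (intro tendsto_intros vis_lim_tail_tendsto c s)
    show "(\<lambda>i. cyc expo ?d x y z (\<lambda>_. s i)) \<longlonglongrightarrow> 0"
      using cyc0 vis_cauchy_in[OF s] by simp
  qed
  show ?thesis
  proof (rule distances_eq_if_cyc_vanishes[OF pos expo_pos])
    show "(?r ^ expo - ?p ^ expo) * ?p + (?q ^ expo - ?r ^ expo) * ?q = 0"
      using lim[OF c(1)] by (simp add: cyc_def sym self c algebra_simps)
    show "(?p ^ expo - ?q ^ expo) * ?p + (?q ^ expo - ?r ^ expo) * ?r = 0"
      using lim[OF c(2)] by (simp add: cyc_def sym self c algebra_simps)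
    show "(?p ^ expo - ?q ^ expo) * ?q + (?r ^ expo - ?p ^ expo) * ?r = 0"
      using lim[OF c(3)] by (simp add: cyc_def sym self c algebra_simps)
  qed
qed

text \<open>A cross ratio does not depend on the base point: both exponents are the same sum of
  distances. This transfers a comparison at \<open>v\<close> to the fixed base
  \<open>b\<close>.\<close>

lemma vis_weight_cross_ratio:
  assumes "v \<in> V" "b \<in> V" "x \<in> V" "y \<in> V" "z \<in> V"
  shows "vis_weight v y z * (vis_weight b z v * vis_weight b x y) =
    vis_weight v x y * (vis_weight b x v * vis_weight b y z)"
  unfolding vis_weight_def mult_exp_exp gromov_product_def
  using dist_sym[of v x] dist_sym[of v y] dist_sym[of v z] assms by (simp add: field_simps)

text \<open>Seen from a vertex \<open>v\<close> far out towards \<open>x\<close>, the ends \<open>y\<close> and \<open>z\<close> are much closer to each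
  other than to \<open>x\<close>.\<close>

lemma ex_base_vis_lim_less:
  assumes b: "b \<in> V" and seq: "x \<in> gromov_sequences G" "y \<in> gromov_sequences G" "z \<in> gromov_sequences G"
    and pos: "vis_lim b x y > 0" "vis_lim b x z > 0" "\<And>v. v \<in> V \<Longrightarrow> vis_lim v x y > 0"
  shows "\<exists>v\<in>V. vis_lim v y z < vis_lim v x y"
proof -
  note c = gromov_sequences_cauchy[OF seq(1)] gromov_sequences_cauchy[OF seq(2)] gromov_sequences_cauchy[OF seq(3)]
  note V = gromov_sequences_in[OF seq(1)] gromov_sequences_in[OF seq(2)] gromov_sequences_in[OF seq(3)]
  let ?p = "vis_lim b x y" and ?q = "vis_lim b x z"
  \<comment> \<open>With the lower bounds \<open>?p / 2\<close> and \<open>?q / 2\<close> and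
    Frink's factor 2, this value makes the final ratio 1/2.\<close>
  define e where "e = ?p * ?q / 16"
  have e: "e > 0" using pos by (simp add: e_def)
  obtain M1 where M1: "\<forall>i\<ge>M1. \<forall>j\<ge>M1. vis_weight b (x i) (x j) < e"
    using gromov_asymptotic_weight[OF _ b e, of x x] seq(1) by (auto simp: gromov_sequences_def)
  obtain M2 where M2: "\<forall>i\<ge>M2. \<forall>j\<ge>M2. \<bar>vis_dist b (x i) (y j) - ?p\<bar> < ?p / 2"
    using vis_lim_joint[OF c(1,2)[OF b], of "?p / 2"] pos by auto
  obtain M3 where M3: "\<forall>i\<ge>M3. \<forall>j\<ge>M3. \<bar>vis_dist b (x i) (z j) - ?q\<bar> < ?q / 2"
    using vis_lim_joint[OF c(1,3)[OF b], of "?q / 2"] pos by auto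
  define M where "M = max M1 (max M2 M3)"
  \<comment> \<open>The far vertex is taken on the sequence \<open>x\<close> itself, from where all
    three estimates hold.\<close>
  define v where "v = x M"
  have v: "v \<in> V" using V by (simp add: v_def)
  have "vis_dist v (y i) (z i) \<le> vis_dist v (x i) (y i) / 2" if i: "i \<ge> M" for i
  proof -
    let ?x = "x i" and ?y = "y i" and ?z = "z i"
    have "\<bar>vis_dist b ?x ?y - ?p\<bar> < ?p / 2" using M2 i by (simp add: M_def)
    then have xy: "?p / 2 < vis_dist b ?x ?y" by linarith
    have "\<bar>vis_dist b v ?z - ?q\<bar> < ?q / 2" using M3 i by (simp add: M_def v_def)
    then have "?q / 2 < vis_dist b v ?z" by linarith
    then have zv: "?q / 2 < vis_weight b ?z v"
      using vis_dist_le_weight[OF V(3) v, of b i] vis_dist_sym[OF V(3) v, of b i] by linarith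
    have xy': "?p / 2 < vis_weight b ?x ?y" using xy vis_dist_le_weight[OF V(1,2), of b i i] by linarith
    have "vis_dist b ?x ?y > 0" using xy pos by simp
    then have ne: "?x \<noteq> ?y" using vis_dist_refl[OF V(1), of b i] by force
    have "vis_dist v ?y ?z * (?q / 2 * (?p / 2)) \<le> vis_weight v ?y ?z * (vis_weight b ?z v * vis_weight b ?x ?y)"
      using zv xy' pos by (intro mult_mono vis_dist_le_weight V) (auto simp: vis_weight_def)
    also have "\<dots> = vis_weight v ?x ?y * (vis_weight b ?x v * vis_weight b ?y ?z)"
      using v b V by (intro vis_weight_cross_ratio)
    also have "\<dots> \<le> (2 * vis_dist v ?x ?y) * (e * 1)"
    proof (intro mult_mono)
      show "vis_weight v ?x ?y \<le> 2 * vis_dist v ?x ?y" by (rule weight_le_vis_dist[OF v V(1,2) ne])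
      show "vis_weight b ?x v \<le> e"
        using M1[rule_format, of i M] i by (simp add: M_def v_def)
      show "vis_weight b ?y ?z \<le> 1"
        using gp_nonneg[OF b V(2,3)] eps_pos by (simp add: vis_weight_def)
    qed (use e vis_dist_nonneg[OF V(1,2)] in \<open>auto simp: vis_weight_def\<close>)
    also have "\<dots> = (vis_dist v ?x ?y / 2) * (?q / 2 * (?p / 2))" by (simp add: e_def)
    finally show ?thesis using pos by (simp add: mult_le_cancel_right)
  qed
  then have "vis_lim v y z \<le> vis_lim v x y / 2"
    by (intro LIMSEQ_le[OF vis_lim_tendsto[OF c(2)[OF v] c(3)[OF v]]
          tendsto_divide[OF vis_lim_tendsto[OF c(1)[OF v] c(2)[OF v]] tendsto_const]] exI[of _ M]) auto
  then show ?thesis using pos(3)[OF v] v by (intro bexI[of _ v]) auto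
qed

lemma cochain_nonzero:
  assumes \<xi>: "\<xi> \<in> bdry" and \<eta>: "\<eta> \<in> bdry" and \<zeta>: "\<zeta> \<in> bdry" and ne: "\<xi> \<noteq> \<eta>" "\<eta> \<noteq> \<zeta>" "\<xi> \<noteq> \<zeta>"
  shows "\<exists>v\<in>V. \<exists>w\<in>V. cochain v w (rep \<xi>) (rep \<eta>) (rep \<zeta>) \<noteq> 0"
proof (rule ccontr)
  let ?x = "rep \<xi>" and ?y = "rep \<eta>" and ?z = "rep \<zeta>"
  assume "\<not> ?thesis"
  then have 0: "cochain v w ?x ?y ?z = 0" if "v \<in> V" "w \<in> V" for v w using that by blast
  have pos: "vis_lim v ?x ?y > 0" "vis_lim v ?x ?z > 0" "vis_lim v ?z ?x > 0" "vis_lim v ?y ?z > 0"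
    if "v \<in> V" for v
    using bdist_pos that \<xi> \<eta> \<zeta> ne unfolding bdist_def by blast+
  have seq: "?x \<in> gromov_sequences G" "?y \<in> gromov_sequences G" "?z \<in> gromov_sequences G"
    using boundary_sequence rep_in \<xi> \<eta> \<zeta> by blast+
  have b: "?x 0 \<in> V" using gromov_sequences_in[OF seq(1)] .
  obtain v where v: "v \<in> V" "vis_lim v ?y ?z < vis_lim v ?x ?y"
    using ex_base_vis_lim_less[OF b seq pos(1)[OF b] pos(2)[OF b] pos(1)] by blast
  moreover have "vis_lim v ?x ?y = vis_lim v ?y ?z"
    using v(1) rep_cauchy \<xi> \<eta> \<zeta> pos 0 by (intro vis_lim_eq_if_cochain_vanishes) auto
  ultimately show False by simp
qed

text \<open>Passing from vertices to edges requires every vertex to be an origin. Two boundary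
  points force a second vertex, and a walk to it starts with an arc at \<open>v\<close>.\<close>

lemma ex_out_arc:
  assumes "\<xi> \<in> bdry" "\<eta> \<in> bdry" "\<xi> \<noteq> \<eta>" "v \<in> V"
  shows "\<exists>e\<in>arcs G. tail G e = v"
proof -
  have "\<exists>u\<in>V. u \<noteq> v"
  proof (rule ccontr)
    assume "\<not> ?thesis"
    then have "rep \<xi> i = v" "rep \<eta> i = v" for i
      using vis_cauchy_in[OF rep_cauchy] assms by blast+
    then have "bdist v \<xi> \<eta> = 0" using assms(4) by (simp add: bdist_def vis_lim_def vis_dist_refl)
    then show False using bdist_pos[OF assms] by simp
  qed
  then obtain u where u: "u \<in> V" "u \<noteq> v" by blast
  obtain p where p: "awalk v p u" using ex_awalk u assms(4) by blast
  then show ?thesis using u(2) by (cases p) (auto simp: awalk_Cons_iff awalk_Nil_iff)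
qed

section \<open>The cocycle on pairs of edges\<close>

definition omega ::
    "(nat \<Rightarrow> 'v) set \<Rightarrow> (nat \<Rightarrow> 'v) set \<Rightarrow> (nat \<Rightarrow> 'v) set \<Rightarrow> 'e \<times> 'e \<Rightarrow> real" where
  "omega \<xi> \<eta> \<zeta> = (\<lambda>(e, f). if e \<in> arcs G \<and> f \<in> arcs G
     then cochain (tail G e) (tail G f) (rep \<xi>) (rep \<eta>) (rep \<zeta>) else 0)"

text \<open>At most \<open>N * N\<close> pairs of arcs have a given pair of origins.\<close>

lemma sum_arc_pairs:
  fixes h :: "'v \<times> 'v \<Rightarrow> real"
  assumes A: "finite A" "A \<subseteq> arcs G \<times> arcs G" and h: "\<And>p. h p \<ge> 0"
    and bound: "\<And>B. finite B \<Longrightarrow> B \<subseteq> V \<times> V \<Longrightarrow> sum h B \<le> C"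
  shows "(\<Sum>a\<in>A. h (map_prod (tail G) (tail G) a)) \<le> real (N * N) * C"
proof -
  let ?T = "map_prod (tail G) (tail G)"
  have TA: "?T ` A \<subseteq> V \<times> V" using A by auto
  have "(\<Sum>a\<in>A. h (?T a)) = (\<Sum>p\<in>?T ` A. \<Sum>a | a \<in> A \<and> ?T a = p. h (?T a))"
    by (rule sum.image_gen[OF A(1)])
  also have "\<dots> = (\<Sum>p\<in>?T ` A. real (card {a \<in> A. ?T a = p}) * h p)"
    by (intro sum.cong refl) simp
  also have "\<dots> \<le> (\<Sum>p\<in>?T ` A. real (N * N) * h p)"
  proof (intro sum_mono mult_right_mono h)
    fix p assume "p \<in> ?T ` A"
    then obtain v w where p: "p = (v, w)" "v \<in> V" "w \<in> V" using TA by auto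
    have "card {a \<in> A. ?T a = p} \<le> card (out_arcs G v \<times> out_arcs G w)"
      using p A finite_out by (intro card_mono) auto
    also have "\<dots> \<le> N * N" using card_out p by (simp add: card_cartesian_product mult_le_mono)
    finally show "real (card {a \<in> A. ?T a = p}) \<le> real (N * N)" by (simp only: of_nat_le_iff)
  qed
  also have "\<dots> = real (N * N) * sum h (?T ` A)" by (simp add: sum_distrib_left)
  also have "\<dots> \<le> real (N * N) * C" using A TA by (intro mult_left_mono bound) auto
  finally show ?thesis .
qed

lemma sum_omega:
  assumes "\<xi> \<in> bdry" "\<eta> \<in> bdry" "\<zeta> \<in> bdry" and A: "finite A" "A \<subseteq> arcs G \<times> arcs G"
  shows "(\<Sum>a\<in>A. \<bar>omega \<xi> \<eta> \<zeta> a\<bar>) \<le> real (N * N) * total_const"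
proof -
  define h where "h = (\<lambda>(v, w). \<bar>cochain v w (rep \<xi>) (rep \<eta>) (rep \<zeta>)\<bar>)"
  have "(\<Sum>a\<in>A. \<bar>omega \<xi> \<eta> \<zeta> a\<bar>) = (\<Sum>a\<in>A. h (map_prod (tail G) (tail G) a))"
    using A(2) by (intro sum.cong refl) (auto simp: omega_def h_def)
  also have "\<dots> \<le> real (N * N) * total_const"
  proof (rule sum_arc_pairs[OF A])
    show "sum h B \<le> total_const" if "finite B" "B \<subseteq> V \<times> V" for B
      unfolding h_def by (intro sum_cochain rep_cauchy assms that)
  qed (simp add: h_def split: prod.split)
  finally show ?thesis .
qed

lemma omega_l1:
  assumes "\<xi> \<in> bdry" "\<eta> \<in> bdry" "\<zeta> \<in> bdry"
  shows "omega \<xi> \<eta> \<zeta> \<in> l1_space (arcs G \<times> arcs G)"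
  unfolding l1_space_def
  using infsum_le_bound(1)[of "arcs G \<times> arcs G" "\<lambda>a. \<bar>omega \<xi> \<eta> \<zeta> a\<bar>", OF _ sum_omega[OF assms]]
  by (auto simp: omega_def)

lemma omega_continuous:
  "continuous_map
     (prod_topology (boundary_topology G)
        (prod_topology (boundary_topology G) (boundary_topology G)))
     (weak_star_topology (arcs G \<times> arcs G)) (\<lambda>(\<xi>, \<eta>, \<zeta>). omega \<xi> \<eta> \<zeta>)"
  (is "continuous_map ?X _ _")
proof (rule continuous_map_weak_star)
  fix t B assume B: "t \<in> topspace ?X" "finite B" "B \<subseteq> arcs G \<times> arcs G"
  then obtain \<xi> \<eta> \<zeta> where "t = (\<xi>, \<eta>, \<zeta>)" "\<xi> \<in> bdry" "\<eta> \<in> bdry" "\<zeta> \<in> bdry"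
    by (auto simp: topspace_boundary_topology)
  then show "(\<Sum>a\<in>B. \<bar>(case t of (\<xi>, \<eta>, \<zeta>) \<Rightarrow> omega \<xi> \<eta> \<zeta>) a\<bar>) \<le> real (N * N) * total_const"
    using sum_omega B(2,3) by simp
next
  fix t a assume "t \<in> topspace ?X" "a \<notin> arcs G \<times> arcs G"
  then show "(case t of (\<xi>, \<eta>, \<zeta>) \<Rightarrow> omega \<xi> \<eta> \<zeta>) a = 0"
    by (auto simp: omega_def split: prod.splits)
next
  fix a assume "a \<in> arcs G \<times> arcs G"
  then obtain e f where a: "a = (e, f)" "e \<in> arcs G" "f \<in> arcs G" by auto
  then have V: "tail G e \<in> V" "tail G f \<in> V" by auto
  have pr: "continuous_map ?X (boundary_topology G) fst"
    "continuous_map ?X (boundary_topology G) (\<lambda>t. fst (snd t))"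
    "continuous_map ?X (boundary_topology G) (\<lambda>t. snd (snd t))"
    by (auto intro: continuous_map_fst continuous_map_fst_of[unfolded o_def]
        continuous_map_snd_of[unfolded o_def] continuous_map_snd)
  \<comment> \<open>Each coordinate of \<open>omega\<close> is a polynomial in distances between
    ideal points and distances to a fixed vertex; the latter are 1-Lipschitz for
    \<open>bdist\<close>.\<close>
  have "continuous_map (boundary_topology G) euclideanreal (\<lambda>\<xi>. vis_lim (tail G e) (rep \<xi>) (\<lambda>_. tail G f))"
    by (rule lipschitz_continuous_map[OF V(1)])
       (auto simp: bdist_def intro!: vis_lim_lipschitz rep_cauchy vis_cauchy_const V)
  note w = continuous_map_compose[OF pr(1) this, unfolded o_def]
    continuous_map_compose[OF pr(2) this, unfolded o_def]
    continuous_map_compose[OF pr(3) this, unfolded o_def]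
  have "continuous_map ?X euclideanreal (\<lambda>t. cochain (tail G e) (tail G f)
      (rep (fst t)) (rep (fst (snd t))) (rep (snd (snd t))))"
    unfolding cochain_def cyc_def
    by (intro continuous_map_real_mult continuous_map_add continuous_map_diff continuous_map_real_pow
        w continuous_map_bdist[OF V(1), unfolded bdist_def] pr) auto
  then show "continuous_map ?X euclideanreal (\<lambda>t. (case t of (\<xi>, \<eta>, \<zeta>) \<Rightarrow> omega \<xi> \<eta> \<zeta>) a)"
    using a by (simp add: omega_def case_prod_unfold)
qed

text \<open>The representative chosen in an image class is \<open>\<phi> \<circ> x\<close> for some
  \<open>x\<close> in the original class, though perhaps not for the chosen one. Invariance of the
  cochain is therefore combined with its independence of representatives.\<close>

lemma omega_equivariant:
  assumes auto: "graph_automorphism G arev \<phi> \<psi>"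
    and \<xi>: "\<xi> \<in> bdry" and \<eta>: "\<eta> \<in> bdry" and \<zeta>: "\<zeta> \<in> bdry"
  shows "omega (boundary_action \<phi> \<xi>) (boundary_action \<phi> \<eta>) (boundary_action \<phi> \<zeta>) =
    l1_action (arcs G) \<psi> (omega \<xi> \<eta> \<zeta>)"
proof (intro ext, clarify)
  fix a b
  let ?k = "inv_into (arcs G) \<psi>"
  have \<psi>: "bij_betw \<psi> (arcs G) (arcs G)" "\<And>e. e \<in> arcs G \<Longrightarrow> tail G (\<psi> e) = \<phi> (tail G e)"
    using auto by (auto simp: graph_automorphism_def)
  have k: "?k e \<in> arcs G" "tail G e = \<phi> (tail G (?k e))" if "e \<in> arcs G" for e
    using that \<psi>(2)[of "?k e"] bij_betw_apply[OF bij_betw_inv_into[OF \<psi>(1)]]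
    by (auto simp: bij_betw_inv_into_right[OF \<psi>(1)])
  have ex: "\<exists>x\<in>\<alpha>. rep (boundary_action \<phi> \<alpha>) = \<phi> \<circ> x" if "\<alpha> \<in> bdry" for \<alpha>
  proof -
    have "\<phi> \<circ> rep \<alpha> \<in> boundary_action \<phi> \<alpha>" using rep_in[OF that] by (simp add: boundary_action_def)
    then have "rep (boundary_action \<phi> \<alpha>) \<in> boundary_action \<phi> \<alpha>"
      unfolding rep_def[of "boundary_action \<phi> \<alpha>"] by (rule someI[where P = "\<lambda>x. x \<in> boundary_action \<phi> \<alpha>"])
    then show ?thesis by (auto simp: boundary_action_def)
  qed
  obtain x where x: "x \<in> \<xi>" "rep (boundary_action \<phi> \<xi>) = \<phi> \<circ> x" using ex[OF \<xi>] by blast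
  obtain y where y: "y \<in> \<eta>" "rep (boundary_action \<phi> \<eta>) = \<phi> \<circ> y" using ex[OF \<eta>] by blast
  obtain z where z: "z \<in> \<zeta>" "rep (boundary_action \<phi> \<zeta>) = \<phi> \<circ> z" using ex[OF \<zeta>] by blast
  have V: "x i \<in> V" "y i \<in> V" "z i \<in> V" for i
    using gromov_sequences_in boundary_sequence \<xi> \<eta> \<zeta> x y z by blast+
  show "omega (boundary_action \<phi> \<xi>) (boundary_action \<phi> \<eta>) (boundary_action \<phi> \<zeta>) (a, b) =
      l1_action (arcs G) \<psi> (omega \<xi> \<eta> \<zeta>) (a, b)"
  proof (cases "a \<in> arcs G \<and> b \<in> arcs G")
    case True
    then have ab: "a \<in> arcs G" "b \<in> arcs G" by auto
    have T: "tail G (?k a) \<in> V" "tail G (?k b) \<in> V" using k(1) ab by auto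
    have "cochain (tail G a) (tail G b) (\<phi> \<circ> x) (\<phi> \<circ> y) (\<phi> \<circ> z)
        = cochain (tail G (?k a)) (tail G (?k b)) x y z"
      unfolding k(2)[OF ab(1)] k(2)[OF ab(2)] by (rule cochain_automorphism[OF auto T V])
    also have "\<dots> = cochain (tail G (?k a)) (tail G (?k b)) (rep \<xi>) (rep \<eta>) (rep \<zeta>)"
      by (rule cochain_cong[OF \<xi> \<eta> \<zeta> x(1) y(1) z(1) T])
    finally show ?thesis using ab k(1) by (simp add: omega_def l1_action_def x y z)
  next
    case False
    then show ?thesis by (auto simp: omega_def l1_action_def)
  qed
qed

lemma rep_sym: "\<xi> \<in> bdry \<Longrightarrow> \<eta> \<in> bdry \<Longrightarrow> e \<in> arcs G \<Longrightarrow>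
    vis_lim (tail G e) (rep \<xi>) (rep \<eta>) = vis_lim (tail G e) (rep \<eta>) (rep \<xi>)"
  by (intro vis_lim_sym rep_cauchy) auto

lemma omega_alternating: "alternating_on bdry omega"
proof (rule alternating_onI)
  fix \<xi> \<eta> \<zeta> and p :: "'e \<times> 'e" assume b: "\<xi> \<in> bdry" "\<eta> \<in> bdry" "\<zeta> \<in> bdry"
  obtain e f where p: "p = (e, f)" by (cases p)
  show "omega \<eta> \<xi> \<zeta> p = - omega \<xi> \<eta> \<zeta> p"
  proof (cases "e \<in> arcs G \<and> f \<in> arcs G")
    case True
    let ?c = "\<lambda>\<alpha> \<beta> \<gamma>. cyc expo (vis_lim (tail G e)) (rep \<alpha>) (rep \<beta>) (rep \<gamma>) (\<lambda>_. tail G f)"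
    have "?c \<eta> \<xi> \<zeta> = - ?c \<xi> \<eta> \<zeta>" using b True by (intro cyc_swap rep_sym) auto
    then show ?thesis using True by (simp add: p omega_def cochain_def)
  qed (auto simp: p omega_def)
next
  fix \<xi> \<eta> \<zeta> p
  show "omega \<eta> \<zeta> \<xi> p = omega \<xi> \<eta> \<zeta> p"
    by (simp add: omega_def cochain_def cyc_rotate[of _ _ "rep \<xi>"] split: prod.split)
qed

lemma omega_cocycle: "cocycle_on bdry omega"
  unfolding cocycle_on_def
proof (intro ballI allI)
  fix \<xi> \<eta> \<zeta> \<theta> and p :: "'e \<times> 'e" assume b: "\<xi> \<in> bdry" "\<eta> \<in> bdry" "\<zeta> \<in> bdry" "\<theta> \<in> bdry"
  obtain e f where p: "p = (e, f)" by (cases p)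
  show "omega \<eta> \<zeta> \<theta> p - omega \<xi> \<zeta> \<theta> p + omega \<xi> \<eta> \<theta> p - omega \<xi> \<eta> \<zeta> p = 0"
  proof (cases "e \<in> arcs G \<and> f \<in> arcs G")
    case True
    let ?c = "\<lambda>\<alpha> \<beta> \<gamma>. cyc expo (vis_lim (tail G e)) (rep \<alpha>) (rep \<beta>) (rep \<gamma>) (\<lambda>_. tail G f)"
    have "?c \<eta> \<zeta> \<theta> - ?c \<xi> \<zeta> \<theta> + ?c \<xi> \<eta> \<theta> - ?c \<xi> \<eta> \<zeta> = 0"
      using b True by (intro cyc_cocycle rep_sym) auto
    then show ?thesis using True by (simp add: p omega_def cochain_def flip: distrib_left right_diff_distrib)
  qed (auto simp: p omega_def)
qed

lemma omega_nonzero: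
  assumes "\<xi> \<in> bdry" "\<eta> \<in> bdry" "\<zeta> \<in> bdry" "\<xi> \<noteq> \<eta>" "\<eta> \<noteq> \<zeta>" "\<xi> \<noteq> \<zeta>"
  shows "omega \<xi> \<eta> \<zeta> \<noteq> (\<lambda>_. 0)"
proof
  assume 0: "omega \<xi> \<eta> \<zeta> = (\<lambda>_. 0)"
  obtain v w where vw: "v \<in> V" "w \<in> V" "cochain v w (rep \<xi>) (rep \<eta>) (rep \<zeta>) \<noteq> 0"
    using cochain_nonzero[OF assms] by blast
  obtain e where e: "e \<in> arcs G" "tail G e = v" using ex_out_arc[OF assms(1,2,4) vw(1)] by blast
  obtain f where f: "f \<in> arcs G" "tail G f = w" using ex_out_arc[OF assms(1,2,4) vw(2)] by blast
  show False using fun_cong[OF 0, of "(e, f)"] e f vw(3) by (simp add: omega_def)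
qed

end

theorem theorem18:
  fixes G :: "('v, 'e) pre_digraph" and arev :: "'e \<Rightarrow> 'e"
  assumes "serre_graph G arev"
    and "bounded_valency G"
    and "hyperbolic_graph G"
  shows "\<exists>\<omega> :: (nat \<Rightarrow> 'v) set \<Rightarrow> (nat \<Rightarrow> 'v) set \<Rightarrow> (nat \<Rightarrow> 'v) set \<Rightarrow> ('e \<times> 'e \<Rightarrow> real).
     (\<forall>\<xi>\<in>gromov_boundary G. \<forall>\<eta>\<in>gromov_boundary G. \<forall>\<zeta>\<in>gromov_boundary G.
        \<omega> \<xi> \<eta> \<zeta> \<in> l1_space (arcs G \<times> arcs G)) \<and>
     continuous_map
       (prod_topology (boundary_topology G)
          (prod_topology (boundary_topology G) (boundary_topology G)))
       (weak_star_topology (arcs G \<times> arcs G)) (\<lambda>(\<xi>, \<eta>, \<zeta>). \<omega> \<xi> \<eta> \<zeta>) \<and>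
     (\<forall>\<phi> \<psi>. graph_automorphism G arev \<phi> \<psi> \<longrightarrow>
        (\<forall>\<xi>\<in>gromov_boundary G. \<forall>\<eta>\<in>gromov_boundary G. \<forall>\<zeta>\<in>gromov_boundary G.
           \<omega> (boundary_action \<phi> \<xi>) (boundary_action \<phi> \<eta>) (boundary_action \<phi> \<zeta>) =
           l1_action (arcs G) \<psi> (\<omega> \<xi> \<eta> \<zeta>))) \<and>
     alternating_on (gromov_boundary G) \<omega> \<and>
     cocycle_on (gromov_boundary G) \<omega> \<and>
     (\<forall>\<xi>\<in>gromov_boundary G. \<forall>\<eta>\<in>gromov_boundary G. \<forall>\<zeta>\<in>gromov_boundary G.
        \<xi> \<noteq> \<eta> \<longrightarrow> \<eta> \<noteq> \<zeta> \<longrightarrow> \<xi> \<noteq> \<zeta> \<longrightarrow> \<omega> \<xi> \<eta> \<zeta> \<noteq> (\<lambda>_. 0))"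
proof -
  obtain N where N: "\<And>v. v \<in> verts G \<Longrightarrow> finite (out_arcs G v) \<and> card (out_arcs G v) \<le> N"
    using assms(2) unfolding bounded_valency_def by blast
  obtain \<delta> where \<delta>: "\<delta> \<ge> 0" "\<And>x y z b. x \<in> verts G \<Longrightarrow> y \<in> verts G \<Longrightarrow> z \<in> verts G \<Longrightarrow> b \<in> verts G \<Longrightarrow>
      gromov_product G b x z \<ge> min (gromov_product G b x y) (gromov_product G b y z) - \<delta>"
    using assms(3) unfolding hyperbolic_graph_def by blast
  interpret bidirected_digraph G arev using assms(1) by (simp add: serre_graph_def)
  interpret hyperbolic_serre_graph G arev N \<delta>
    using assms(1) N \<delta> by unfold_locales (auto simp: serre_graph_def)
  show ?thesis
    using omega_l1 omega_continuous omega_equivariant omega_alternating omega_cocycle omega_nonzero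
    by (intro exI[of _ omega]) blast
qed

end
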